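(* Let $N\ge 1$, let $Q$ be a real symmetric non-negative definite $N\times N$ matrix and let $A$ be a real $N\times N$ matrix such that the Kalman condition $$\mathrm{rank}\,[\sqrt{Q},\,A\sqrt{Q},\,\ldots,\,A^{N-1}\sqrt{Q}]=N$$ holds. Let $L$ be the Ornstein–Uhlenbeck operator associated with $(Q,A)$. Let $u\in C^2(\mathbb{R}^N)$ be a non-negative function with $Lu=0$ on $\mathbb{R}^N$, and assume that there exist $\delta\in[0,1)$ and $C_\delta>0$ such that $$|u(x)|\le C_\delta(1+|x|^\delta),\qquad x\in\mathbb{R}^N.$$ If $s(A)\le 0$, then $u$ is constant.
   Context: $|\cdot|$ is the Euclidean norm and $\langle\cdot,\cdot\rangle$ the Euclidean inner product on $\mathbb{R}^N$. The Ornstein–Uhlenbeck operator associated with $(Q,A)$ acts on $C^2$ functions $u:\mathbb{R}^N\to\mathbb{R}$ by $$Lu(x)=\tfrac12\,\mathrm{tr}(Q D^2u(x))+\langle Ax, Du(x)\rangle,\qquad x\in\mathbb{R}^N,$$ where $D^2u$ is the Hessian matrix and $Du$ the gradient of $u$. The matrix in the Kalman condition is the $N\times N^2$ matrix obtained by juxtaposing the blocks $A^j\sqrt{Q}$, $0\le j\le N-1$, and $\sqrt{Q}$ is the symmetric non-negative square root of $Q$. The spectral bound of $A$ is $s(A)=\max\{\mathrm{Re}(\lambda):\lambda\in\sigma(A)\}$, where $\sigma(A)$ is the set of (complex) eigenvalues of $A$. *)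

theory Defs
  imports "HOL-Analysis.Analysis"
begin

text \<open>Throughout, $N$ is \<open>CARD('n)\<close> and $N \times N$ matrices have type \<open>real^'n^'n\<close>.\<close>

definition symmetric_matrix :: "real^'n^'n \<Rightarrow> bool" where
  "symmetric_matrix M \<longleftrightarrow> transpose M = M"

definition nonneg_definite :: "real^'n^'n \<Rightarrow> bool" where
  "nonneg_definite M \<longleftrightarrow> (\<forall>x. 0 \<le> x \<bullet> (M *v x))"

text \<open>For symmetric non-negative definite \<open>Q\<close> such an \<open>R\<close> exists and is unique; the
  description is meaningful only for such \<open>Q\<close>.\<close>

definition matrix_sqrt :: "real^'n^'n \<Rightarrow> real^'n^'n" where
  "matrix_sqrt Q = (THE R. symmetric_matrix R \<and> nonneg_definite R \<and> R ** R = Q)"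

text \<open>The overloaded power \<open>A ^ k\<close> on the type \<open>real^'n^'n\<close> is the componentwise one,
  hence a separate definition of the power with respect to the matrix product.\<close>

primrec matrix_power :: "real^'n^'n \<Rightarrow> nat \<Rightarrow> real^'n^'n" where
  "matrix_power A 0 = mat 1"
| "matrix_power A (Suc k) = A ** matrix_power A k"

text \<open>The $N \times N^2$ matrix with blocks $A^j \sqrt Q$, $0 \le j \le N-1$. A column index
  is a pair \<open>p\<close> consisting of a block index \<open>fst p\<close> and a column index \<open>snd p\<close> within that
  block; \<open>to_nat_on UNIV\<close> is a bijection of \<open>'n\<close> onto \<open>{..<CARD('n)}\<close>. The order in which the
  blocks are juxtaposed is immaterial for the rank.\<close>

definition kalman_matrix :: "real^'n^'n \<Rightarrow> real^'n^'n \<Rightarrow> real^('n \<times> 'n)^'n" where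
  "kalman_matrix Q A =
     (\<chi> i p. (matrix_power A (to_nat_on (UNIV :: 'n set) (fst p)) ** matrix_sqrt Q) $ i $ snd p)"

lemma columns_kalman_matrix:
  fixes Q A :: "real^'n^'n"
  shows "columns (kalman_matrix Q A)
           = (\<Union>j<CARD('n). columns (matrix_power A j ** matrix_sqrt Q))"
proof -
  let ?t = "to_nat_on (UNIV :: 'n set)"
  have t: "?t ` UNIV = {..<CARD('n)}"
    using to_nat_on_finite[of "UNIV :: 'n set"] by (simp add: bij_betw_def)
  have col: "column (b, k) (kalman_matrix Q A)
               = column k (matrix_power A (?t b) ** matrix_sqrt Q)" for b k
    by (simp add: column_def kalman_matrix_def vec_eq_iff)
  have "columns (kalman_matrix Q A)
          = (\<Union>b. columns (matrix_power A (?t b) ** matrix_sqrt Q))"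
    unfolding columns_def using col by (fastforce simp: set_eq_iff)
  also have "\<dots> = (\<Union>j\<in>?t ` UNIV. columns (matrix_power A j ** matrix_sqrt Q))"
    by blast
  finally show ?thesis
    by (simp only: t)
qed

definition kalman_condition :: "real^'n^'n \<Rightarrow> real^'n^'n \<Rightarrow> bool" where
  "kalman_condition Q A \<longleftrightarrow> rank (kalman_matrix Q A) = CARD('n)"

definition complex_spectrum :: "real^'n^'n \<Rightarrow> complex set" where
  "complex_spectrum A =
     {c. \<exists>v :: complex^'n. v \<noteq> 0 \<and> (\<chi> i j. complex_of_real (A $ i $ j)) *v v = c *s v}"

definition spectral_bound :: "real^'n^'n \<Rightarrow> real" where
  "spectral_bound A = Max (Re ` complex_spectrum A)"

definition gradient :: "(real^'n \<Rightarrow> real) \<Rightarrow> real^'n \<Rightarrow> real^'n" where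
  "gradient u x = (THE D. GDERIV u x :> D)"

definition hessian :: "(real^'n \<Rightarrow> real) \<Rightarrow> real^'n \<Rightarrow> real^'n^'n" where
  "hessian u x = jacobian (gradient u) (at x)"

definition C2_function :: "(real^'n \<Rightarrow> real) \<Rightarrow> bool" where
  "C2_function u \<longleftrightarrow>
     (\<forall>x. u differentiable at x) \<and>
     (\<forall>x. gradient u differentiable at x) \<and>
     continuous_on UNIV (hessian u)"

definition ornstein_uhlenbeck ::
    "real^'n^'n \<Rightarrow> real^'n^'n \<Rightarrow> (real^'n \<Rightarrow> real) \<Rightarrow> real^'n \<Rightarrow> real" where
  "ornstein_uhlenbeck Q A u x =
     1 / 2 * trace (Q ** hessian u x) + (A *v x) \<bullet> gradient u x"

text \<open>The power $r^\delta$ for $r, \delta \ge 0$ with the convention $0^0 = 1$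
  (whereas \<open>0 powr 0 = 0\<close>).\<close>

definition rpow :: "real \<Rightarrow> real \<Rightarrow> real" where
  "rpow r \<delta> = (if \<delta> = 0 then 1 else r powr \<delta>)"

end

theory Submission
  imports Defs "HOL-Computational_Algebra.Fundamental_Theorem_Algebra"
    "HOL-Real_Asymp.Real_Asymp"
begin

text \<open>The function \<open>u\<close> is shown to be midpoint convex, that is \<open>2 u(x) \<le> u(x + h) + u(x - h)\<close> for all \<open>x\<close>
  and \<open>h\<close>. A convex function of sublinear growth is constant
  (\<open>midpoint_convex_sublinear_constant\<close>).

  Convexity comes from a control argument. Let a control \<open>g\<close> on \<open>[0, T]\<close> steer \<open>\<xi>' = A \<xi> - Q g\<close> from
  \<open>\<xi>(0) = h\<close> to \<open>\<xi>(T) = 0\<close>. Probabilistically, shifting the Ornstein--Uhlenbeck process started at \<open>x\<close> by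
  \<open>\<plusminus>\<xi>\<close> amounts to a change of measure with density \<open>exp (\<plusminus>Z - a)\<close>, where \<open>Z\<close> is a stochastic integral
  of \<open>g\<close> and \<open>a\<close> half the energy of \<open>g\<close>; since \<open>u \<ge> 0\<close> and \<open>exp Z + exp (- Z) \<ge> 2\<close>, it follows that
  \<open>u(x + h) + u(x - h) \<ge> 2 exp (- a) u(x)\<close>. No process is needed for this: the tilted translates
  \<open>exp (c z - c\<^sup>2 a(s)) u(y + c \<xi>(s))\<close> with \<open>c = 1, - 1, 0\<close> solve one linear backward parabolic equation
  in \<open>(s, y, z)\<close> (\<open>tilt_backward_equation\<close>), and the inequality between them is propagated from time \<open>T\<close>
  to time \<open>0\<close> by the maximum principle (\<open>translates_along_control\<close>).

  It remains to find controls of arbitrarily small energy (\<open>steering_with_small_energy\<close>). The least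
  energy is \<open>h \<bullet> S(T)\<^sup>-\<^sup>1 h\<close> with the Gramian \<open>S(T)\<close>, the integral of \<open>exp (- t A) Q exp (- t A)\<^sup>T\<close> over \<open>[0, T]\<close>,
  so \<open>S(T)\<close> has to tend to infinity in every direction. The directions in which it stays bounded form
  a subspace invariant under \<open>A\<^sup>T\<close>. An eigenvector of \<open>A\<^sup>T\<close> in its complexification has an eigenvalue
  with non-positive real part, so the integrand does not decay along it and must vanish; this
  contradicts the Kalman condition (\<open>output_energy_unbounded\<close>).\<close>

section \<open>The square root of a symmetric non-negative definite matrix\<close>

lemma symmetric_matrix_inner:
  fixes M :: "real^'n^'n"
  assumes "symmetric_matrix M"
  shows "(M *v x) \<bullet> y = x \<bullet> (M *v y)"
  using assms by (metis dot_lmul_matrix symmetric_matrix_def transpose_matrix_vector)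

text \<open>A maximiser \<open>x\<close> of the Rayleigh quotient on the unit sphere of the invariant subspace
  \<open>V\<close> is an eigenvector: moving from \<open>x\<close> in the direction of the residual
  \<open>M x - (x \<bullet> M x) x\<close>, which lies in \<open>V\<close>, would increase the quotient otherwise.\<close>

lemma symmetric_matrix_eigenvector_in_subspace:
  fixes M :: "real^'n^'n"
  assumes M: "symmetric_matrix M" and V: "subspace V"
    and inv: "\<And>x. x \<in> V \<Longrightarrow> M *v x \<in> V" and nz: "v \<in> V" "v \<noteq> 0"
  obtains x \<mu> where "x \<in> V" "norm x = 1" "M *v x = \<mu> *\<^sub>R x"
proof -
  let ?S = "V \<inter> sphere 0 1"
  have "compact ?S"
    by (simp add: V closed_subspace closed_Int_compact)
  moreover have "(1 / norm v) *\<^sub>R v \<in> ?S"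
    using nz V by (simp add: subspace_scale)
  moreover have "continuous_on ?S (\<lambda>x. x \<bullet> (M *v x))"
    by (intro continuous_intros)
  ultimately obtain x where x: "x \<in> ?S" and mx: "\<And>y. y \<in> ?S \<Longrightarrow> y \<bullet> (M *v y) \<le> x \<bullet> (M *v x)"
    using continuous_attains_sup[of ?S "\<lambda>x. x \<bullet> (M *v x)"] by blast
  define \<mu> where "\<mu> = x \<bullet> (M *v x)"
  have x1: "norm x = 1" "x \<bullet> x = 1" "x \<in> V"
    using x by (auto simp: norm_eq_1)
  have quad: "y \<bullet> (M *v y) \<le> \<mu> * (y \<bullet> y)" if "y \<in> V" for y
  proof (cases "y = 0")
    case False
    have "(1 / norm y) *\<^sub>R y \<in> ?S"
      using False V that by (simp add: subspace_scale)
    from mx[OF this] have "(y \<bullet> (M *v y)) / (norm y)^2 \<le> \<mu>"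
      by (simp add: \<mu>_def matrix_vector_mult_scaleR power2_eq_square)
    then show ?thesis
      using False by (simp add: divide_le_eq power2_norm_eq_inner)
  qed simp
  define w where "w = M *v x - \<mu> *\<^sub>R x"
  have wV: "w \<in> V"
    unfolding w_def using x1 V inv by (simp add: subspace_diff subspace_scale)
  have xw: "x \<bullet> w = 0"
    using x1 by (simp add: w_def inner_diff_right \<mu>_def)
  have ww: "w \<bullet> (M *v x) = w \<bullet> w"
    using xw by (simp add: w_def inner_diff_right inner_commute)
  define K where "K = w \<bullet> (M *v w) - \<mu> * (w \<bullet> w)"
  \<comment> \<open>The quotient at \<open>x + t w\<close> exceeds its maximum to first order in \<open>t\<close> unless \<open>w = 0\<close>.\<close>
  have bound: "2 * t * (w \<bullet> w) + t^2 * K \<le> 0" for t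
  proof -
    have "x + t *\<^sub>R w \<in> V"
      using x1 wV V by (simp add: subspace_add subspace_scale)
    from quad[OF this] have "\<mu> + 2 * t * (w \<bullet> (M *v x)) + t^2 * (w \<bullet> (M *v w)) \<le> \<mu> * (1 + t^2 * (w \<bullet> w))"
      using x1 xw symmetric_matrix_inner[OF M, of x w]
      by (simp add: matrix_vector_right_distrib matrix_vector_mult_scaleR inner_add_left
          inner_add_right \<mu>_def power2_eq_square inner_commute algebra_simps)
    then show ?thesis
      using ww by (simp add: K_def algebra_simps)
  qed
  have "w \<bullet> w = 0"
  proof (rule ccontr)
    assume "w \<bullet> w \<noteq> 0"
    then have p: "w \<bullet> w > 0" by simp
    \<comment> \<open>This \<open>t\<close> is so small that the linear term outweighs the quadratic one.\<close>
    define t where "t = (w \<bullet> w) / (1 + \<bar>K\<bar>)"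
    have t: "t > 0" using p by (simp add: t_def)
    have "t * \<bar>K\<bar> \<le> w \<bullet> w"
      using p by (simp add: t_def divide_le_eq mult_left_mono)
    then have "2 * (w \<bullet> w) + t * K > 0"
      using p by (smt (verit) abs_ge_minus_self mult_minus_right mult_left_mono t)
    then have "t * (2 * (w \<bullet> w) + t * K) > 0"
      using t by simp
    with bound[of t] show False
      by (simp add: power2_eq_square algebra_simps)
  qed
  then have "M *v x = \<mu> *\<^sub>R x"
    by (simp add: w_def)
  with x1 that show thesis by blast
qed

text \<open>An orthonormal set of eigenvectors of maximal size spans the space, since otherwise its
  orthogonal complement, which is invariant by symmetry, contains a further eigenvector.\<close>

lemma symmetric_matrix_orthonormal_eigenbasis:
  fixes M :: "real^'n^'n"
  assumes M: "symmetric_matrix M"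
  obtains B l where "finite B" "pairwise orthogonal B" "\<And>b. b \<in> B \<Longrightarrow> norm b = 1"
    "\<And>b. b \<in> B \<Longrightarrow> M *v b = l b *\<^sub>R b" "span B = UNIV"
proof -
  define P where "P B \<longleftrightarrow> pairwise orthogonal B \<and> (\<forall>b\<in>B. norm b = 1 \<and> (\<exists>\<mu>. M *v b = \<mu> *\<^sub>R b))"
    for B :: "(real^'n) set"
  have bd: "finite B \<and> card B \<le> CARD('n)" if "P B" for B
  proof -
    have "0 \<notin> B" using that by (auto simp: P_def)
    then have "independent B"
      using that pairwise_orthogonal_independent by (auto simp: P_def)
    then show ?thesis
      using independent_bound by auto
  qed
  have "P {}" by (simp add: P_def)
  then obtain B where B: "P B" and mxB: "\<And>C. P C \<Longrightarrow> card C \<le> card B"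
    using ex_has_greatest_nat[of P "{}" card "Suc CARD('n)"] bd by (auto simp: less_Suc_eq_le)
  have fin: "finite B" using bd B by blast
  have sp: "span B = UNIV"
  proof (rule ccontr)
    assume "span B \<noteq> UNIV"
    then obtain a where a: "a \<noteq> 0" "\<And>x. x \<in> span B \<Longrightarrow> orthogonal a x"
      using orthogonal_to_subspace_exists_gen[of B UNIV] by auto
    define V where "V = {x. \<forall>b\<in>B. b \<bullet> x = 0}"
    have sV: "subspace V"
      by (auto simp: V_def subspace_def inner_add_right)
    have aV: "a \<in> V"
      using a(2) span_base by (auto simp: V_def orthogonal_def inner_commute)
    have inv: "M *v x \<in> V" if "x \<in> V" for x
    proof -
      have "b \<bullet> (M *v x) = 0" if b: "b \<in> B" for b
      proof -
        obtain \<mu> where "M *v b = \<mu> *\<^sub>R b" using B b by (auto simp: P_def)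
        then have "b \<bullet> (M *v x) = \<mu> * (b \<bullet> x)"
          by (metis symmetric_matrix_inner[OF M] inner_scaleR_left)
        then show ?thesis using b \<open>x \<in> V\<close> by (simp add: V_def)
      qed
      then show ?thesis by (simp add: V_def)
    qed
    obtain x \<mu> where x: "x \<in> V" "norm x = 1" "M *v x = \<mu> *\<^sub>R x"
      using symmetric_matrix_eigenvector_in_subspace[OF M sV inv aV a(1)] by blast
    have "x \<notin> B"
      using x by (auto simp: V_def norm_eq_1)
    moreover have "P (insert x B)"
      using B x by (auto simp: P_def V_def pairwise_insert orthogonal_def inner_commute)
    ultimately show False
      using mxB[of "insert x B"] fin by simp
  qed
  have "\<forall>b\<in>B. \<exists>\<mu>. M *v b = \<mu> *\<^sub>R b" using B by (auto simp: P_def)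
  then obtain l where "\<forall>b\<in>B. M *v b = l b *\<^sub>R b" by metis
  with that[of B l] B fin sp show thesis by (auto simp: P_def)
qed

lemma matrix_eq_on_spanning_set:
  fixes M M' :: "real^'n^'n"
  assumes "span B = UNIV" "\<And>b. b \<in> B \<Longrightarrow> M *v b = M' *v b"
  shows "M = M'"
proof -
  have "M *v x = M' *v x" for x
    using assms linear_eq_on_span[of "(*v) M" "(*v) M'" B x] by simp
  then show ?thesis
    by (simp add: matrix_eq)
qed

text \<open>On an \<open>l\<close>-eigenvector of its square, a non-negative definite symmetric matrix acts as
  \<open>sqrt l\<close>, because it cannot have the negative eigenvalue \<open>- sqrt l\<close>.\<close>

lemma nonneg_definite_on_eigenvector_of_square:
  fixes R :: "real^'n^'n"
  assumes R: "symmetric_matrix R" "nonneg_definite R" and e: "(R ** R) *v b = l *\<^sub>R b"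
    and l: "0 \<le> l"
  shows "R *v b = sqrt l *\<^sub>R b"
proof (cases "l = 0")
  case True
  have "(R *v b) \<bullet> (R *v b) = b \<bullet> ((R ** R) *v b)"
    by (simp add: symmetric_matrix_inner[OF R(1)] matrix_vector_mul_assoc)
  then show ?thesis using True e by simp
next
  case False
  define w where "w = R *v b - sqrt l *\<^sub>R b"
  have "R *v (R *v b) = l *\<^sub>R b"
    using e by (simp add: matrix_vector_mul_assoc)
  then have "R *v w = - (sqrt l *\<^sub>R w)"
    using l by (simp add: w_def matrix_vector_mult_diff_distrib matrix_vector_mult_scaleR
        scaleR_right_diff_distrib)
  then have "- (sqrt l * (w \<bullet> w)) \<ge> 0"
    using R(2) unfolding nonneg_definite_def by (metis inner_minus_right inner_scaleR_right)
  moreover have "sqrt l > 0" using False l by simp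
  ultimately have "w \<bullet> w \<le> 0"
    by (metis linorder_not_le mult_pos_pos neg_0_le_iff_le)
  then have "w = 0" by (meson inner_ge_zero inner_eq_zero_iff order_antisym)
  then show ?thesis by (simp add: w_def)
qed

lemma matrix_sqrt_ex1:
  fixes Q :: "real^'n^'n"
  assumes Q: "symmetric_matrix Q" "nonneg_definite Q"
  shows "\<exists>!R. symmetric_matrix R \<and> nonneg_definite R \<and> R ** R = Q"
proof -
  obtain B l where B: "finite B" "pairwise orthogonal B" "\<And>b. b \<in> B \<Longrightarrow> norm b = 1"
    "\<And>b. b \<in> B \<Longrightarrow> Q *v b = l b *\<^sub>R b" "span B = UNIV"
    using symmetric_matrix_orthonormal_eigenbasis[OF Q(1)] by blast
  have l0: "0 \<le> l b" if "b \<in> B" for b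
  proof -
    have "0 \<le> b \<bullet> (Q *v b)" using Q(2) by (simp add: nonneg_definite_def)
    then show ?thesis using B(3,4)[OF that] by (simp add: norm_eq_1)
  qed
  define r where "r x = (\<Sum>b\<in>B. (sqrt (l b) * (b \<bullet> x)) *\<^sub>R b)" for x
  define R where "R = matrix r"
  have "linear r"
    by (rule linearI)
      (simp_all add: r_def inner_add_right algebra_simps sum.distrib scaleR_sum_right)
  then have Rv: "R *v x = r x" for x
    by (simp add: R_def matrix_works)
  have sym: "(R *v x) \<bullet> y = x \<bullet> (R *v y)" for x y
    by (simp add: Rv r_def inner_sum_left inner_sum_right inner_commute mult.commute mult.left_commute)
  have "transpose R *v y = R *v y" for y
    by (rule vector_eq_ldot[THEN iffD1])
      (metis sym dot_lmul_matrix transpose_matrix_vector transpose_transpose)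
  then have sR: "symmetric_matrix R"
    by (simp add: symmetric_matrix_def matrix_eq)
  have nR: "nonneg_definite R"
    unfolding nonneg_definite_def Rv r_def inner_sum_right
    by (auto intro!: sum_nonneg simp: l0 inner_commute mult.assoc)
  have "R *v b = sqrt (l b) *\<^sub>R b" if "b \<in> B" for b
  proof -
    have "R *v b = (\<Sum>c\<in>B. if c = b then sqrt (l b) *\<^sub>R b else 0)"
      unfolding Rv r_def using B(2,3) that
      by (intro sum.cong) (auto simp: pairwise_def orthogonal_def norm_eq_1)
    then show ?thesis using B(1) that by simp
  qed
  then have "(R ** R) *v b = Q *v b" if "b \<in> B" for b
    using that l0 B(4) by (simp add: matrix_vector_mult_scaleR flip: matrix_vector_mul_assoc)
  then have "R ** R = Q"
    using matrix_eq_on_spanning_set B(5) by blast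
  moreover have "S = S'"
    if "symmetric_matrix S" "nonneg_definite S" "S ** S = Q"
      "symmetric_matrix S'" "nonneg_definite S'" "S' ** S' = Q" for S S'
  proof (rule matrix_eq_on_spanning_set[OF B(5)])
    fix b assume b: "b \<in> B"
    show "S *v b = S' *v b"
      using nonneg_definite_on_eigenvector_of_square[of S b "l b"]
        nonneg_definite_on_eigenvector_of_square[of S' b "l b"] that B(4)[OF b] l0[OF b] by simp
  qed
  ultimately show ?thesis
    using sR nR by blast
qed

lemma matrix_sqrt:
  fixes Q :: "real^'n^'n"
  assumes "symmetric_matrix Q" "nonneg_definite Q"
  shows "symmetric_matrix (matrix_sqrt Q)" "matrix_sqrt Q ** matrix_sqrt Q = Q"
  using theI'[OF matrix_sqrt_ex1[OF assms]] by (auto simp: matrix_sqrt_def)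

section \<open>The matrix exponential\<close>

lemma matrix_power_Suc_right: "matrix_power M (Suc k) = matrix_power M k ** M"
proof (induction k)
  case (Suc k)
  have "matrix_power M (Suc (Suc k)) = M ** (matrix_power M k ** M)"
    using Suc by simp
  then show ?case by (simp add: matrix_mul_assoc)
qed simp

lemma transpose_matrix_power: "transpose (matrix_power M k) = matrix_power (transpose M) k"
proof (induction k)
  case (Suc k)
  have "transpose (matrix_power M (Suc k)) = transpose (matrix_power M k) ** transpose M"
    by (simp add: matrix_transpose_mul)
  then show ?case using Suc by (simp only: matrix_power_Suc_right)
qed (simp add: transpose_mat)

lemma matrix_power_entry_bound:
  fixes M :: "real^'n^'n"
  shows "\<bar>matrix_power M k $ i $ j\<bar> \<le> (\<Sum>i\<in>UNIV. \<Sum>j\<in>UNIV. \<bar>M $ i $ j\<bar>) ^ k"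
proof (induction k arbitrary: i j)
  case 0
  then show ?case by (simp add: mat_def)
next
  case (Suc k)
  let ?m = "\<Sum>i\<in>UNIV. \<Sum>j\<in>UNIV. \<bar>M $ i $ j\<bar>"
  have "\<bar>matrix_power M (Suc k) $ i $ j\<bar> \<le> (\<Sum>l\<in>UNIV. \<bar>M $ i $ l\<bar> * \<bar>matrix_power M k $ l $ j\<bar>)"
    by (simp add: matrix_matrix_mult_def flip: abs_mult)
  also have "\<dots> \<le> (\<Sum>l\<in>UNIV. \<bar>M $ i $ l\<bar> * ?m ^ k)"
    by (intro sum_mono mult_left_mono Suc) simp
  also have "\<dots> = (\<Sum>l\<in>UNIV. \<bar>M $ i $ l\<bar>) * ?m ^ k"
    by (simp add: sum_distrib_right)
  also have "\<dots> \<le> ?m * ?m ^ k"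
    by (intro mult_right_mono member_le_sum[of i UNIV "\<lambda>i. \<Sum>l\<in>UNIV. \<bar>M $ i $ l\<bar>"])
      (simp_all add: sum_nonneg)
  finally show ?case by simp
qed

text \<open>The value at \<open>t\<close> is \<open>exp (t M)\<close> for the matrix product. With the series taken entry by
  entry, termwise differentiation is that of real power series.\<close>

definition mexp :: "real^'n^'n \<Rightarrow> real \<Rightarrow> real^'n^'n" where
  "mexp M t = (\<chi> i j. \<Sum>k. matrix_power M k $ i $ j / fact k * t ^ k)"

lemma summable_mexp_entry:
  fixes M :: "real^'n^'n"
  shows "summable (\<lambda>k. matrix_power M k $ i $ j / fact k * t ^ k)"
proof (rule summable_comparison_test')
  let ?m = "\<Sum>i\<in>UNIV. \<Sum>j\<in>UNIV. \<bar>M $ i $ j\<bar>"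
  show "summable (\<lambda>k. inverse (fact k) * (?m * \<bar>t\<bar>) ^ k)"
    by (rule summable_exp)
  show "norm (matrix_power M k $ i $ j / fact k * t ^ k) \<le> inverse (fact k) * (?m * \<bar>t\<bar>) ^ k" for k
    using matrix_power_entry_bound[of M k i j]
    by (simp add: abs_mult power_mult_distrib power_abs divide_simps mult_right_mono)
qed

lemma diffs_matrix_power:
  fixes M :: "real^'n^'n"
  shows "diffs (\<lambda>k. matrix_power M k $ i $ j / fact k) k = matrix_power M (Suc k) $ i $ j / fact k"
  by (simp add: diffs_def del: matrix_power.simps of_nat_Suc)

lemma mult_mexp_entry:
  fixes M :: "real^'n^'n"
  shows "(M ** mexp M t) $ i $ j = (\<Sum>k. matrix_power M (Suc k) $ i $ j / fact k * t ^ k)"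
proof -
  have "(M ** mexp M t) $ i $ j
      = (\<Sum>l\<in>UNIV. \<Sum>k. M $ i $ l * (matrix_power M k $ l $ j / fact k * t ^ k))"
    by (simp add: matrix_matrix_mult_def mexp_def suminf_mult[OF summable_mexp_entry] del: times_divide_eq_left)
  also have "\<dots> = (\<Sum>k. \<Sum>l\<in>UNIV. M $ i $ l * (matrix_power M k $ l $ j / fact k * t ^ k))"
    by (rule suminf_sum[symmetric]) (intro summable_mult summable_mexp_entry)
  finally show ?thesis
    by (simp add: matrix_matrix_mult_def sum_divide_distrib sum_distrib_right mult.assoc)
qed

lemma mexp_entry_has_derivative:
  fixes M :: "real^'n^'n"
  shows "((\<lambda>t. mexp M t $ i $ j) has_real_derivative (M ** mexp M t) $ i $ j) (at t within S)"
  using has_field_derivative_at_within[OF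
      termdiffs_strong_converges_everywhere[OF summable_mexp_entry[of M i j], of t], of S]
  by (simp only: mexp_def vec_lambda_beta diffs_matrix_power mult_mexp_entry[unfolded mexp_def])

lemma mexp_mult_entry:
  fixes M :: "real^'n^'n"
  shows "(mexp M t ** M) $ i $ j = (\<Sum>k. matrix_power M (Suc k) $ i $ j / fact k * t ^ k)"
proof -
  have "(mexp M t ** M) $ i $ j
      = (\<Sum>l\<in>UNIV. \<Sum>k. (matrix_power M k $ i $ l / fact k * t ^ k) * M $ l $ j)"
    by (simp add: matrix_matrix_mult_def mexp_def suminf_mult2[OF summable_mexp_entry] del: times_divide_eq_left)
  also have "\<dots> = (\<Sum>k. \<Sum>l\<in>UNIV. (matrix_power M k $ i $ l / fact k * t ^ k) * M $ l $ j)"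
    by (rule suminf_sum[symmetric]) (intro summable_mult2 summable_mexp_entry)
  finally show ?thesis
    unfolding matrix_power_Suc_right
    by (simp add: matrix_matrix_mult_def sum_divide_distrib sum_distrib_right sum_distrib_left mult_ac)
qed

lemma mexp_commute: "mexp M t ** M = M ** mexp M t"
  by (simp add: vec_eq_iff mult_mexp_entry mexp_mult_entry)

lemma has_vector_derivative_matrix_entrywise:
  fixes f :: "real \<Rightarrow> real^'m^'n"
  assumes "\<And>i j. ((\<lambda>t. f t $ i $ j) has_real_derivative (f' $ i $ j)) (at t within S)"
  shows "(f has_vector_derivative f') (at t within S)"
  unfolding has_vector_derivative_def has_derivative_componentwise_within[of f]
proof
  fix b :: "real^'m^'n" assume "b \<in> Basis"
  then obtain i j where b: "b = axis i (axis j 1)"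
    by (auto simp: Basis_vec_def)
  show "((\<lambda>x. f x \<bullet> b) has_derivative (\<lambda>x. (x *\<^sub>R f') \<bullet> b)) (at t within S)"
    using assms[of i j] by (simp add: b inner_axis has_field_derivative_def mult_commute_abs)
qed

lemma mexp_has_vector_derivative:
  "(mexp M has_vector_derivative (M ** mexp M t)) (at t within S)"
  by (intro has_vector_derivative_matrix_entrywise mexp_entry_has_derivative)

lemma bounded_bilinear_matrix_mult:
  "bounded_bilinear ((**) :: real^'m^'n \<Rightarrow> real^'k^'m \<Rightarrow> real^'k^'n)"
  unfolding bilinear_conv_bounded_bilinear[symmetric] bilinear_def
  by (auto intro!: linearI simp: vec_eq_iff
      matrix_matrix_mult_def sum.distrib sum_distrib_left algebra_simps)

lemma bounded_bilinear_matrix_vector_mult: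
  "bounded_bilinear ((*v) :: real^'m^'n \<Rightarrow> real^'m \<Rightarrow> real^'n)"
  unfolding bilinear_conv_bounded_bilinear[symmetric] bilinear_def
  by (auto intro!: linearI simp: matrix_vector_right_distrib matrix_vector_mult_add_rdistrib
      matrix_vector_mult_scaleR scaleR_matrix_vector_assoc)

lemma mexp_0 [simp]: "mexp M 0 = mat 1"
  by (simp add: mexp_def vec_eq_iff mat_def powser_zero del: times_divide_eq_left)

lemma transpose_mexp: "transpose (mexp M t) = mexp (transpose M) t"
proof -
  have "matrix_power (transpose M) k $ i $ j = matrix_power M k $ j $ i" for k i j
    unfolding transpose_matrix_power[symmetric] by (simp add: transpose_def)
  then show ?thesis by (simp add: mexp_def vec_eq_iff transpose_def[of "\<chi> i j. f i j" for f])
qed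

text \<open>Along \<open>t\<close> the derivative of \<open>mexp (- M) t ** mexp M (s + t)\<close> vanishes; this single
  identity contains both the inverse and the group law.\<close>

lemma mexp_minus_mult_mexp_add: "mexp (- M) t ** mexp M (s + t) = mexp M s"
proof -
  interpret mm: bounded_bilinear "(**) :: real^'n^'n \<Rightarrow> real^'n^'n \<Rightarrow> real^'n^'n"
    by (rule bounded_bilinear_matrix_mult)
  have shift: "((\<lambda>t. mexp M (s + t)) has_vector_derivative (M ** mexp M (s + t))) (at t within S)" for t S
  proof -
    have "((\<lambda>t. s + t) has_vector_derivative 1) (at t within S)"
      by (auto intro!: derivative_eq_intros)
    from vector_diff_chain_within[OF this mexp_has_vector_derivative]
    show ?thesis by (simp add: o_def)
  qed
  have "((\<lambda>t. mexp (- M) t ** mexp M (s + t)) has_vector_derivative 0) (at t within UNIV)" for t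
  proof -
    have "((\<lambda>t. mexp (- M) t ** mexp M (s + t)) has_vector_derivative
      (mexp (- M) t ** (M ** mexp M (s + t)) + (- M ** mexp (- M) t) ** mexp M (s + t))) (at t)"
      using mm.has_vector_derivative[OF mexp_has_vector_derivative shift] by simp
    moreover have "- M ** mexp (- M) t = - (mexp (- M) t ** M)"
      by (simp add: mm.minus_right flip: mexp_commute)
    then have "(- M ** mexp (- M) t) ** mexp M (s + t) = - (mexp (- M) t ** (M ** mexp M (s + t)))"
      by (simp add: mm.minus_left matrix_mul_assoc)
    ultimately show ?thesis by simp
  qed
  then obtain c where "\<And>t. mexp (- M) t ** mexp M (s + t) = c"
    using has_vector_derivative_zero_constant[of UNIV "\<lambda>t. mexp (- M) t ** mexp M (s + t)"] by auto
  from this[of t] this[of 0] show ?thesis by simp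
qed

lemma mexp_minus_mult_mexp [simp]: "mexp (- M) t ** mexp M t = mat 1"
  using mexp_minus_mult_mexp_add[of M t 0] by simp

lemma mexp_mult_mexp_minus [simp]: "mexp M t ** mexp (- M) t = mat 1"
  using mexp_minus_mult_mexp[of "- M"] by simp

lemma mexp_add: "mexp M (s + t) = mexp M t ** mexp M s"
  by (metis matrix_mul_assoc matrix_mul_lid mexp_minus_mult_mexp_add mexp_mult_mexp_minus)

lemma continuous_on_mexp: "continuous_on S (mexp M)"
  by (meson continuous_on_vector_derivative mexp_has_vector_derivative)

section \<open>Eigenvalues\<close>

lemma nontrivial_linear_relation:
  fixes x :: "nat \<Rightarrow> 'a::euclidean_space"
  obtains c :: "nat \<Rightarrow> real" and i where "i \<le> DIM('a)" "c i \<noteq> 0" "(\<Sum>i\<le>DIM('a). c i *\<^sub>R x i) = 0"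
proof (cases "inj_on x {..DIM('a)}")
  case True
  then have "card (x ` {..DIM('a)}) > DIM('a)"
    by (simp add: card_image)
  then have "dependent (x ` {..DIM('a)})"
    by (intro dependent_biggerset) simp
  then obtain u v where "v \<in> x ` {..DIM('a)}" "u v \<noteq> 0" "(\<Sum>v\<in>x ` {..DIM('a)}. u v *\<^sub>R v) = 0"
    by (auto simp: dependent_finite)
  with True that[of _ "u \<circ> x"] show thesis
    by (auto simp: sum.reindex)
next
  case False
  then obtain i j where ij: "i \<le> DIM('a)" "j \<le> DIM('a)" "i \<noteq> j" "x i = x j"
    by (auto simp: inj_on_def)
  define c :: "nat \<Rightarrow> real" where "c k = (if k = i then 1 else 0) - (if k = j then 1 else 0)" for k
  have "(\<Sum>k\<le>DIM('a). c k *\<^sub>R x k) =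
     (\<Sum>k\<le>DIM('a). (if k = i then x k else 0) - (if k = j then x k else 0))"
    by (intro sum.cong) (auto simp: c_def)
  also have "\<dots> = 0"
    using ij by (simp add: sum_subtractf)
  finally show thesis
    using that[of i c] ij by (simp add: c_def)
qed

definition complex_matrix :: "real^'n^'n \<Rightarrow> complex^'n^'n" where
  "complex_matrix M = (\<chi> i j. complex_of_real (M $ i $ j))"

definition poly_apply :: "complex poly \<Rightarrow> complex^'n^'n \<Rightarrow> complex^'n \<Rightarrow> complex^'n" where
  "poly_apply p C v = (\<Sum>k\<le>degree p. coeff p k *s (((*v) C ^^ k) v))"

lemma poly_apply_upto:
  assumes "degree p \<le> d"
  shows "poly_apply p C v = (\<Sum>k\<le>d. coeff p k *s (((*v) C ^^ k) v))"
  unfolding poly_apply_def using assms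
  by (intro sum.mono_neutral_left) (auto simp: coeff_eq_0)

lemma matrix_funpow_scale: "((*v) C ^^ k) (l *s v) = l *s (((*v) C ^^ k) v)"
  for C :: "complex^'n^'n"
  by (induction k) (simp_all add: vector_scalar_commute)

lemma matrix_funpow_diff: "((*v) C ^^ k) (v - w) = ((*v) C ^^ k) v - ((*v) C ^^ k) w"
  for C :: "complex^'n^'n"
  by (induction k) (simp_all add: matrix_vector_mult_diff_distrib)

lemma poly_apply_linear_factor:
  "poly_apply ([:- l, 1:] * q) C v = poly_apply q C (C *v v - l *s v)"
proof (cases "q = 0")
  case False
  let ?d = "degree q"
  have c: "coeff ([:- l, 1:] * q) k = (case k of 0 \<Rightarrow> 0 | Suc k' \<Rightarrow> coeff q k') - l * coeff q k" for k
    by (simp add: coeff_pCons split: nat.splits)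
  have "poly_apply ([:- l, 1:] * q) C v
      = (\<Sum>k\<le>Suc ?d. (case k of 0 \<Rightarrow> 0 | Suc k' \<Rightarrow> coeff q k') *s (((*v) C ^^ k) v))
        - (\<Sum>k\<le>Suc ?d. (l * coeff q k) *s (((*v) C ^^ k) v))"
    using degree_mult_le[of "[:- l, 1:]" q]
    by (subst poly_apply_upto[of _ "Suc ?d"])
      (simp_all only: c vector_sub_rdistrib sum_subtractf, simp)
  also have "(\<Sum>k\<le>Suc ?d. (case k of 0 \<Rightarrow> 0 | Suc k' \<Rightarrow> coeff q k') *s (((*v) C ^^ k) v))
      = (\<Sum>k\<le>?d. coeff q k *s (((*v) C ^^ k) (C *v v)))"
    by (subst sum.atMost_Suc_shift) (simp add: funpow_swap1)
  also have "(\<Sum>k\<le>Suc ?d. (l * coeff q k) *s (((*v) C ^^ k) v))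
      = (\<Sum>k\<le>?d. coeff q k *s (((*v) C ^^ k) (l *s v)))"
    by (simp add: coeff_eq_0 matrix_funpow_scale mult.commute)
  finally show ?thesis
    by (simp add: poly_apply_def matrix_funpow_diff vector_ssub_ldistrib sum_subtractf)
qed (simp add: poly_apply_def)

lemma poly_apply_eigenvector:
  assumes "C *v v = l *s v"
  shows "poly_apply p C v = poly p l *s v"
proof -
  have "((*v) C ^^ k) v = l ^ k *s v" for k
    by (induction k) (simp_all add: assms vector_scalar_commute)
  then show ?thesis
    by (simp add: poly_apply_def poly_altdef vec_eq_iff sum_distrib_right mult.assoc)
qed

text \<open>The powers of \<open>M\<close> lie in a space of finite dimension, so they satisfy a linear relation.\<close>

lemma annihilating_polynomial:
  fixes M :: "real^'n^'n"
  obtains p where "p \<noteq> 0" "\<And>v. poly_apply p (complex_matrix M) v = 0"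
proof -
  let ?d = "DIM(real^'n^'n)"
  obtain c :: "nat \<Rightarrow> real" and i where c: "i \<le> ?d" "c i \<noteq> 0" "(\<Sum>i\<le>?d. c i *\<^sub>R matrix_power M i) = 0"
    by (rule nontrivial_linear_relation[of "matrix_power M"]) blast
  define p where "p = (\<Sum>k\<le>?d. monom (complex_of_real (c k)) k)"
  have cp: "coeff p k = (if k \<le> ?d then complex_of_real (c k) else 0)" for k
    by (simp add: p_def coeff_sum)
  have "p \<noteq> 0"
    using c cp[of i] by auto
  have dp: "degree p \<le> ?d"
    using cp by (intro degree_le) simp
  have row: "(complex_matrix M *v w) $ j = (\<Sum>m\<in>UNIV. complex_of_real (M $ j $ m) * w $ m)" for w j
    by (simp add: matrix_vector_mult_def complex_matrix_def)
  have pw: "(((*v) (complex_matrix M) ^^ k) v) $ j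
      = (\<Sum>l\<in>UNIV. complex_of_real (matrix_power M k $ j $ l) * v $ l)" for k v j
  proof (induction k arbitrary: j)
    case 0
    then show ?case
      by (simp add: mat_def if_distrib[of "\<lambda>x. x * _"] if_distrib[of complex_of_real] cong: if_cong)
  next
    case (Suc k)
    have "(((*v) (complex_matrix M) ^^ Suc k) v) $ j
      = (\<Sum>m\<in>UNIV. \<Sum>l\<in>UNIV. complex_of_real (M $ j $ m * matrix_power M k $ m $ l) * v $ l)"
      by (simp add: row Suc sum_distrib_left mult.assoc)
    also have "\<dots> = (\<Sum>l\<in>UNIV. \<Sum>m\<in>UNIV. complex_of_real (M $ j $ m * matrix_power M k $ m $ l) * v $ l)"
      by (rule sum.swap)
    finally show ?case
      by (simp add: matrix_matrix_mult_def sum_distrib_right)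
  qed
  have "poly_apply p (complex_matrix M) v $ j = 0" for v j
  proof -
    have "poly_apply p (complex_matrix M) v $ j
        = (\<Sum>k\<le>?d. \<Sum>l\<in>UNIV. complex_of_real (c k * matrix_power M k $ j $ l) * v $ l)"
      by (simp add: poly_apply_upto[OF dp] cp pw sum_distrib_left mult.assoc)
    also have "\<dots> = (\<Sum>l\<in>UNIV. complex_of_real ((\<Sum>k\<le>?d. c k *\<^sub>R matrix_power M k) $ j $ l) * v $ l)"
      by (subst sum.swap) (simp add: sum_distrib_right)
    finally show ?thesis
      by (simp only: c(3)) simp
  qed
  with that \<open>p \<noteq> 0\<close> show thesis
    by (simp add: vec_eq_iff)
qed

text \<open>Every eigenvalue is a root of an annihilating polynomial. Finiteness makes the maximum that
  defines the spectral bound an upper bound of the real parts.\<close>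

lemma finite_complex_spectrum: "finite (complex_spectrum M)"
proof -
  obtain p where p: "p \<noteq> 0" "\<And>v. poly_apply p (complex_matrix M) v = 0"
    using annihilating_polynomial by blast
  have "complex_spectrum M \<subseteq> {l. poly p l = 0}"
  proof
    fix l assume "l \<in> complex_spectrum M"
    then obtain v where v: "v \<noteq> 0" "complex_matrix M *v v = l *s v"
      by (auto simp: complex_spectrum_def complex_matrix_def)
    then have "poly p l *s v = 0"
      using poly_apply_eigenvector[OF v(2)] p(2) by metis
    with v(1) show "l \<in> {l. poly p l = 0}" by simp
  qed
  then show ?thesis
    using poly_roots_finite[OF p(1)] finite_subset by blast
qed

lemma Re_le_spectral_bound:
  assumes "l \<in> complex_spectrum M"
  shows "Re l \<le> spectral_bound M"
  using assms by (simp add: spectral_bound_def finite_complex_spectrum)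

lemma complex_spectrum_transpose: "complex_spectrum (transpose M) \<subseteq> complex_spectrum M"
proof
  fix l assume "l \<in> complex_spectrum (transpose M)"
  then obtain v where v: "v \<noteq> 0" "complex_matrix (transpose M) *v v = l *s v"
    by (auto simp: complex_spectrum_def complex_matrix_def)
  define K where "K = complex_matrix M - mat l"
  have mat_mult: "mat l *v w = l *s w" for w :: "complex^'n"
    by (simp add: vec_eq_iff matrix_vector_mult_def mat_def if_distrib[of "\<lambda>x. x * _"] cong: if_cong)
  have "transpose K = complex_matrix (transpose M) - mat l"
    by (auto simp: K_def complex_matrix_def transpose_def mat_def vec_eq_iff)
  then have "transpose K *v v = 0"
    using v(2) by (simp add: matrix_vector_mult_diff_rdistrib mat_mult)
  then have "\<not> (\<exists>B. B ** transpose K = mat 1)"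
    using v(1) by (auto simp: matrix_left_invertible_ker)
  then have "\<not> (\<exists>B. B ** K = mat 1)"
    by (metis left_invertible_transpose matrix_left_right_inverse)
  then obtain w where "w \<noteq> 0" "K *v w = 0"
    by (auto simp: matrix_left_invertible_ker)
  then have "complex_matrix M *v w = l *s w"
    by (simp add: K_def matrix_vector_mult_diff_rdistrib mat_mult)
  with \<open>w \<noteq> 0\<close> show "l \<in> complex_spectrum M"
    by (auto simp: complex_spectrum_def complex_matrix_def)
qed

text \<open>Splitting off the roots of a polynomial that annihilates \<open>C\<close> one at a time moves a
  non-zero vector to an eigenvector without leaving any subspace that is invariant under \<open>C\<close>.\<close>

lemma eigenvector_in_invariant_set:
  assumes inv: "\<And>v l. v \<in> V \<Longrightarrow> C *v v - l *s v \<in> V"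
    and "p \<noteq> 0" "v \<in> V" "v \<noteq> 0" "poly_apply p C v = 0"
  shows "\<exists>w\<in>V. w \<noteq> 0 \<and> (\<exists>l. C *v w = l *s w)"
  using assms(2-)
proof (induction "degree p" arbitrary: p v)
  case 0
  then obtain a where "p = [:a:]" by (metis degree_eq_zeroE)
  with 0 show ?case by (simp add: poly_apply_def)
next
  case (Suc n)
  then have "\<not> constant (poly p)" by (simp add: constant_degree)
  then obtain l where "poly p l = 0"
    using fundamental_theorem_of_algebra by blast
  then obtain q where q: "p = [:- l, 1:] * q"
    using poly_eq_0_iff_dvd by (metis dvdE)
  have "q \<noteq> 0" using Suc q by auto
  then have dq: "n = degree q"
    using Suc(2) unfolding q by (subst (asm) degree_mult_eq) auto
  show ?case
  proof (cases "C *v v - l *s v = 0")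
    case True
    then show ?thesis using Suc by auto
  next
    case False
    have "poly_apply q C (C *v v - l *s v) = 0"
      using Suc by (simp only: q poly_apply_linear_factor)
    with Suc.hyps(1)[OF dq \<open>q \<noteq> 0\<close> inv[OF \<open>v \<in> V\<close>] False] show ?thesis .
  qed
qed

text \<open>The two vectors are the real and the imaginary part of a complex eigenvector.\<close>

lemma invariant_subspace_eigenpair:
  fixes M :: "real^'n^'n"
  assumes W: "subspace W" and inv: "\<And>v. v \<in> W \<Longrightarrow> M *v v \<in> W" and v: "v \<in> W" "v \<noteq> 0"
  obtains a b \<alpha> \<beta> where "a \<in> W" "b \<in> W" "a \<noteq> 0 \<or> b \<noteq> 0"
    "M *v a = \<alpha> *\<^sub>R a - \<beta> *\<^sub>R b" "M *v b = \<beta> *\<^sub>R a + \<alpha> *\<^sub>R b"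
    "Complex \<alpha> \<beta> \<in> complex_spectrum M"
proof -
  define re where "re c = (\<chi> i. Re (c $ i))" for c :: "complex^'n"
  define im where "im c = (\<chi> i. Im (c $ i))" for c :: "complex^'n"
  have M_re: "re (complex_matrix M *v c) = M *v re c"
    and M_im: "im (complex_matrix M *v c) = M *v im c" for c
    by (simp_all add: vec_eq_iff re_def im_def matrix_vector_mult_def complex_matrix_def)
  have l_re: "re (l *s c) = Re l *\<^sub>R re c - Im l *\<^sub>R im c"
    and l_im: "im (l *s c) = Im l *\<^sub>R re c + Re l *\<^sub>R im c" for l c
    by (simp_all add: vec_eq_iff re_def im_def)
  have d: "re (c - d) = re c - re d" "im (c - d) = im c - im d" for c d
    by (simp_all add: vec_eq_iff re_def im_def)
  define V where "V = {c. re c \<in> W \<and> im c \<in> W}"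
  define v' where "v' = (\<chi> i. complex_of_real (v $ i))"
  have "re v' = v" "im v' = 0"
    by (simp_all add: v'_def re_def im_def vec_eq_iff)
  then have v': "v' \<in> V" "v' \<noteq> 0"
    using v subspace_0[OF W] by (auto simp: V_def) (simp add: re_def vec_eq_iff)
  have invV: "complex_matrix M *v c - l *s c \<in> V" if "c \<in> V" for c l
    using that W inv
    by (auto simp: V_def d M_re M_im l_re l_im intro!: subspace_diff subspace_add subspace_scale)
  obtain p where "p \<noteq> 0" "\<And>w. poly_apply p (complex_matrix M) w = 0"
    using annihilating_polynomial[of M] by blast
  then obtain c l where c: "c \<in> V" "c \<noteq> 0" "complex_matrix M *v c = l *s c"
    using eigenvector_in_invariant_set[of V "complex_matrix M" p v'] invV v' by blast
  have "re c \<noteq> 0 \<or> im c \<noteq> 0"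
    using c(2) by (auto simp: re_def im_def vec_eq_iff complex_eq_iff)
  moreover have "Complex (Re l) (Im l) \<in> complex_spectrum M"
    using c by (auto simp: complex_spectrum_def complex_matrix_def)
  moreover have "M *v re c = Re l *\<^sub>R re c - Im l *\<^sub>R im c" "M *v im c = Im l *\<^sub>R re c + Re l *\<^sub>R im c"
    using M_re[of c] M_im[of c] by (simp_all only: c(3) l_re l_im)
  ultimately show thesis
    using that[of "re c" "im c" "Re l" "Im l"] c(1) by (auto simp: V_def)
qed

section \<open>Unboundedness of the controllability Gramian\<close>

lemma continuous_on_mexp_comp [continuous_intros]:
  assumes "continuous_on S f"
  shows "continuous_on S (\<lambda>t. mexp M (f t))"
  using continuous_on_compose2[OF continuous_on_mexp[of UNIV M] assms] by simp

lemmas continuous_on_matrix_vector_mult [continuous_intros] =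
  bounded_bilinear.continuous_on[OF bounded_bilinear_matrix_vector_mult]

lemmas continuous_on_matrix_mult [continuous_intros] =
  bounded_bilinear.continuous_on[OF bounded_bilinear_matrix_mult]

text \<open>For \<open>B = - A\<^sup>T\<close> and \<open>R = sqrt Q\<close> this is the quadratic form of the controllability Gramian
  of \<open>(A, Q)\<close> over \<open>[0, T]\<close>, seen as the output energy of the dual system \<open>v' = B v\<close>.\<close>

definition output_energy :: "real^'n^'n \<Rightarrow> real^'n^'n \<Rightarrow> real \<Rightarrow> real^'n \<Rightarrow> real" where
  "output_energy R B T v = integral {0..T} (\<lambda>t. (norm (R *v (mexp B t *v v)))\<^sup>2)"

lemma output_energy_integrable:
  "(\<lambda>t. (norm (R *v (mexp B t *v v)))\<^sup>2) integrable_on {a..b}"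
  by (intro integrable_continuous_real continuous_intros)

lemma output_energy_mono:
  assumes "S \<le> T"
  shows "output_energy R B S v \<le> output_energy R B T v"
  unfolding output_energy_def using assms
  by (intro integral_subset_le output_energy_integrable) auto

lemma output_energy_add:
  "output_energy R B T (v + w) \<le> 2 * output_energy R B T v + 2 * output_energy R B T w"
proof -
  have p: "(norm (x + y))\<^sup>2 \<le> 2 * (norm x)\<^sup>2 + 2 * (norm y)\<^sup>2" for x y :: "real^'n"
    using inner_ge_zero[of "x - y"]
    by (simp add: power2_norm_eq_inner inner_diff_left inner_diff_right inner_add_left
        inner_add_right inner_commute)
  have "output_energy R B T (v + w)
    \<le> integral {0..T} (\<lambda>t. 2 * (norm (R *v (mexp B t *v v)))\<^sup>2 + 2 * (norm (R *v (mexp B t *v w)))\<^sup>2)"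
    unfolding output_energy_def
    by (intro integral_le output_energy_integrable integrable_add integrable_on_mult_right)
      (simp add: matrix_vector_right_distrib p)
  also have "\<dots> = 2 * output_energy R B T v + 2 * output_energy R B T w"
    unfolding output_energy_def
    by (subst integral_add) (auto intro!: integrable_on_mult_right output_energy_integrable)
  finally show ?thesis .
qed

lemma output_energy_scale: "output_energy R B T (c *\<^sub>R v) = c\<^sup>2 * output_energy R B T v"
  by (simp add: output_energy_def matrix_vector_mult_scaleR power_mult_distrib)

lemma output_energy_flow:
  assumes "0 \<le> h" "0 \<le> T"
  shows "output_energy R B T (mexp B h *v v) \<le> output_energy R B (T + h) v"
proof -
  let ?f = "\<lambda>t. (norm (R *v (mexp B t *v v)))\<^sup>2"
  have "output_energy R B T (mexp B h *v v) = integral {0..T} (\<lambda>t. ?f (t + h))"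
    by (simp add: output_energy_def matrix_vector_mul_assoc add.commute[of _ h] flip: mexp_add)
  also have "\<dots> = integral {h..T + h} ?f"
    using integral_shift_Icc_real[of 0 T ?f h] by (simp add: o_def add.commute)
  also have "\<dots> \<le> integral {0..T + h} ?f"
    using assms by (intro integral_subset_le output_energy_integrable) auto
  finally show ?thesis
    by (simp add: output_energy_def)
qed

lemma subspace_bounded_output_energy:
  "subspace {v. \<exists>K. \<forall>T\<ge>0. output_energy R B T v \<le> K}"
proof (rule subspaceI)
  show "0 \<in> {v. \<exists>K. \<forall>T\<ge>0. output_energy R B T v \<le> K}"
    by (auto simp: output_energy_def)
next
  fix v w
  assume "v \<in> {v. \<exists>K. \<forall>T\<ge>0. output_energy R B T v \<le> K}" "w \<in> {v. \<exists>K. \<forall>T\<ge>0. output_energy R B T v \<le> K}"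
  then obtain K L where KL: "\<And>T. T \<ge> 0 \<Longrightarrow> output_energy R B T v \<le> K" "\<And>T. T \<ge> 0 \<Longrightarrow> output_energy R B T w \<le> L"
    by auto
  have "output_energy R B T (v + w) \<le> 2 * K + 2 * L" if "T \<ge> 0" for T
    using output_energy_add[of R B T v w] KL[OF that] by linarith
  then show "v + w \<in> {v. \<exists>K. \<forall>T\<ge>0. output_energy R B T v \<le> K}"
    by auto
next
  fix c v
  assume "v \<in> {v. \<exists>K. \<forall>T\<ge>0. output_energy R B T v \<le> K}"
  then obtain K where "\<And>T. T \<ge> 0 \<Longrightarrow> output_energy R B T v \<le> K"
    by auto
  then have "\<forall>T\<ge>0. output_energy R B T (c *\<^sub>R v) \<le> c\<^sup>2 * K"
    by (simp add: output_energy_scale mult_left_mono)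
  then show "c *\<^sub>R v \<in> {v. \<exists>K. \<forall>T\<ge>0. output_energy R B T v \<le> K}"
    by blast
qed

text \<open>Invariance under the flow is evident, since the flow shifts time. It passes to the
  generator because a subspace is closed and so contains the limit of the difference quotients.\<close>

lemma bounded_output_energy_invariant:
  assumes v: "v \<in> {v. \<exists>K. \<forall>T\<ge>0. output_energy R B T v \<le> K}" (is "v \<in> ?W")
  shows "B *v v \<in> ?W"
proof -
  have flow: "mexp B h *v v \<in> ?W" if "h \<ge> 0" for h
  proof -
    from v obtain K where K: "\<And>T. T \<ge> 0 \<Longrightarrow> output_energy R B T v \<le> K"
      by auto
    have "output_energy R B T (mexp B h *v v) \<le> K" if "T \<ge> 0" for T
      using output_energy_flow[OF \<open>h \<ge> 0\<close> that] K[of "T + h"] \<open>h \<ge> 0\<close> that by (meson add_nonneg_nonneg order_trans)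
    then show ?thesis by blast
  qed
  have sub: "subspace ?W"
    by (rule subspace_bounded_output_energy)
  have "((\<lambda>t. mexp B t *v v) has_vector_derivative B *v v) (at 0 within {0<..})"
    using bounded_linear.has_vector_derivative[OF
        bounded_bilinear.bounded_linear_left[OF bounded_bilinear_matrix_vector_mult, of v]
        mexp_has_vector_derivative[of B 0 "{0<..}"]]
    by simp
  then have "((\<lambda>h. (mexp B h *v v - v - h *\<^sub>R (B *v v)) /\<^sub>R \<bar>h\<bar>) \<longlongrightarrow> 0) (at 0 within {0<..})"
    by (simp add: has_vector_derivative_def has_derivative_at_within)
  moreover have "eventually (\<lambda>h. (mexp B h *v v - v - h *\<^sub>R (B *v v)) /\<^sub>R \<bar>h\<bar>
      = (mexp B h *v v - v) /\<^sub>R h - B *v v) (at 0 within {0<..})"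
    unfolding eventually_at_filter by (rule always_eventually) (simp add: scaleR_diff_right)
  ultimately have "((\<lambda>h. (mexp B h *v v - v) /\<^sub>R h - B *v v) \<longlongrightarrow> 0) (at 0 within {0<..})"
    by (rule Lim_transform_eventually)
  then have "((\<lambda>h. (mexp B h *v v - v) /\<^sub>R h) \<longlongrightarrow> B *v v) (at 0 within {0<..})"
    by (rule LIM_zero_cancel)
  moreover have "eventually (\<lambda>h. (mexp B h *v v - v) /\<^sub>R h \<in> ?W) (at 0 within {0<..})"
  proof -
    have "(mexp B h *v v - v) /\<^sub>R h \<in> ?W" if "h \<in> {0<..}" for h
      using that by (intro subspace_scale[OF sub] subspace_diff[OF sub] flow v) simp
    then show ?thesis
      unfolding eventually_at_filter by (intro always_eventually) blast
  qed
  ultimately show ?thesis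
    by (intro Lim_in_closed_set[OF closed_subspace[OF sub]]) auto
qed

text \<open>On the plane spanned by the real and the imaginary part of an eigenvector with
  eigenvalue \<open>\<alpha> + i\<beta>\<close> the squared norm of the output is a multiple of \<open>exp (2 \<alpha> t)\<close>.\<close>

lemma output_mono_on_eigenpair:
  fixes R B :: "real^'n^'n"
  assumes B: "B *v a = \<alpha> *\<^sub>R a - \<beta> *\<^sub>R b" "B *v b = \<beta> *\<^sub>R a + \<alpha> *\<^sub>R b" and "0 \<le> \<alpha>" "0 \<le> t"
  shows "(norm (R *v a))\<^sup>2 + (norm (R *v b))\<^sup>2
    \<le> (norm (R *v (mexp B t *v a)))\<^sup>2 + (norm (R *v (mexp B t *v b)))\<^sup>2"
proof -
  define f where "f v t = R *v (mexp B t *v v)" for v t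
  have "bounded_linear (\<lambda>X :: real^'n^'n. R *v (X *v v))" for v
    by (intro bounded_linear_compose[OF matrix_vector_mul_bounded_linear]
        bounded_bilinear.bounded_linear_left[OF bounded_bilinear_matrix_vector_mult])
  from bounded_linear.has_vector_derivative[OF this mexp_has_vector_derivative]
  have "(f v has_vector_derivative f (B *v v) t) (at t)" for v t
    unfolding f_def by (simp add: matrix_vector_mul_assoc mexp_commute)
  then have fd: "(f v has_vector_derivative f (B *v v) t) (at t)" for v t .
  have "((\<lambda>t. f v t \<bullet> f v t) has_real_derivative 2 * (f v t \<bullet> f (B *v v) t)) (at t)" for v t
    using bounded_bilinear.has_vector_derivative[OF bounded_bilinear_inner fd[of v t] fd[of v t]]
    by (simp add: has_real_derivative_iff_has_vector_derivative inner_commute)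
  then have "((\<lambda>t. f a t \<bullet> f a t + f b t \<bullet> f b t) has_real_derivative
      2 * (f a t \<bullet> f (B *v a) t) + 2 * (f b t \<bullet> f (B *v b) t)) (at t)" for t
    by (intro DERIV_add)
  moreover have "2 * (f a t \<bullet> f (B *v a) t) + 2 * (f b t \<bullet> f (B *v b) t)
      = 2 * \<alpha> * (f a t \<bullet> f a t + f b t \<bullet> f b t)" for t
    by (simp add: B f_def matrix_vector_mult_diff_distrib matrix_vector_right_distrib
        matrix_vector_mult_scaleR inner_diff_right inner_add_right inner_commute algebra_simps)
  ultimately have "((\<lambda>t. f a t \<bullet> f a t + f b t \<bullet> f b t) has_real_derivative
      2 * \<alpha> * (f a t \<bullet> f a t + f b t \<bullet> f b t)) (at t)" for t
    by simp
  moreover have "0 \<le> 2 * \<alpha> * (f a t \<bullet> f a t + f b t \<bullet> f b t)" for t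
    using \<open>0 \<le> \<alpha>\<close> by simp
  ultimately have "f a 0 \<bullet> f a 0 + f b 0 \<bullet> f b 0 \<le> f a t \<bullet> f a t + f b t \<bullet> f b t"
    using DERIV_nonneg_imp_nondecreasing[OF \<open>0 \<le> t\<close>, of "\<lambda>t. f a t \<bullet> f a t + f b t \<bullet> f b t"] by blast
  then show ?thesis
    by (simp add: f_def power2_norm_eq_inner)
qed

text \<open>The vectors of bounded output energy form a \<open>B\<close>-invariant subspace. If it were not zero, it
  would contain the real and the imaginary part of an eigenvector; on these the output does not
  decay because the spectrum lies in the closed right half-plane, so it vanishes identically,
  which observability rules out.\<close>

lemma output_energy_unbounded:
  fixes R B :: "real^'n^'n"
  assumes spec: "\<And>l. l \<in> complex_spectrum B \<Longrightarrow> 0 \<le> Re l"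
    and obs: "\<And>v. (\<And>k. R *v (matrix_power B k *v v) = 0) \<Longrightarrow> v = 0"
    and v: "v \<noteq> 0"
  obtains T where "T \<ge> 0" "output_energy R B T v > K"
proof (rule ccontr)
  define W where "W = {v. \<exists>K. \<forall>T\<ge>0. output_energy R B T v \<le> K}"
  assume "\<not> thesis"
  with that have "\<forall>T\<ge>0. output_energy R B T v \<le> K"
    by (meson linorder_not_le)
  then have "v \<in> W"
    unfolding W_def by blast
  moreover have "subspace W" "\<And>v. v \<in> W \<Longrightarrow> B *v v \<in> W"
    unfolding W_def by (rule subspace_bounded_output_energy, rule bounded_output_energy_invariant)
  ultimately obtain a b \<alpha> \<beta> where ab: "a \<in> W" "b \<in> W" "a \<noteq> 0 \<or> b \<noteq> 0"
    and B: "B *v a = \<alpha> *\<^sub>R a - \<beta> *\<^sub>R b" "B *v b = \<beta> *\<^sub>R a + \<alpha> *\<^sub>R b"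
    and sp: "Complex \<alpha> \<beta> \<in> complex_spectrum B"
    using invariant_subspace_eigenpair[of W B v] v by blast
  have "0 \<le> \<alpha>" using spec[OF sp] by simp
  define c where "c = (norm (R *v a))\<^sup>2 + (norm (R *v b))\<^sup>2"
  have lower: "T * c \<le> output_energy R B T a + output_energy R B T b" if "T \<ge> 0" for T
  proof -
    have "T * c = integral {0..T} (\<lambda>_. c)"
      using that by simp
    also have "\<dots> \<le> integral {0..T} (\<lambda>t. (norm (R *v (mexp B t *v a)))\<^sup>2 + (norm (R *v (mexp B t *v b)))\<^sup>2)"
      unfolding c_def using output_mono_on_eigenpair[OF B \<open>0 \<le> \<alpha>\<close>]
      by (intro integral_le integrable_add output_energy_integrable) auto
    also have "\<dots> = output_energy R B T a + output_energy R B T b"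
      unfolding output_energy_def by (intro integral_add output_energy_integrable)
    finally show ?thesis .
  qed
  obtain K L where KL: "\<And>T. T \<ge> 0 \<Longrightarrow> output_energy R B T a \<le> K" "\<And>T. T \<ge> 0 \<Longrightarrow> output_energy R B T b \<le> L"
    using ab by (auto simp: W_def)
  have "c \<le> 0"
  proof (rule ccontr)
    assume "\<not> c \<le> 0"
    then have "c > 0" by simp
    define T where "T = (\<bar>K + L\<bar> + 1) / c"
    have "T \<ge> 0" "T * c = \<bar>K + L\<bar> + 1"
      using \<open>c > 0\<close> by (auto simp: T_def)
    with lower[of T] KL[of T] show False by linarith
  qed
  then have "(norm (R *v a))\<^sup>2 = 0" "(norm (R *v b))\<^sup>2 = 0"
    unfolding c_def by (smt (verit) zero_le_power2)+
  then have R0: "R *v a = 0" "R *v b = 0"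
    by auto
  have "R *v (matrix_power B k *v (x *\<^sub>R a + y *\<^sub>R b)) = 0" for k x y
  proof (induction k arbitrary: x y)
    case 0
    then show ?case
      by (simp add: R0 matrix_vector_right_distrib matrix_vector_mult_scaleR)
  next
    case (Suc k)
    have "B *v (x *\<^sub>R a + y *\<^sub>R b) = (x * \<alpha> + y * \<beta>) *\<^sub>R a + (y * \<alpha> - x * \<beta>) *\<^sub>R b"
      by (simp add: B matrix_vector_right_distrib matrix_vector_mult_scaleR algebra_simps)
    then show ?case
      using Suc[of "x * \<alpha> + y * \<beta>" "y * \<alpha> - x * \<beta>"]
      by (simp add: matrix_power_Suc_right del: matrix_power.simps flip: matrix_vector_mul_assoc)
  qed
  from obs[of a] obs[of b] this[of _ 1 0] this[of _ 0 1] ab(3) show False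
    by auto
qed

definition gramian :: "real^'n^'n \<Rightarrow> real^'n^'n \<Rightarrow> real \<Rightarrow> real^'n^'n" where
  "gramian A Q T = integral {0..T} (\<lambda>t. mexp (- A) t ** Q ** transpose (mexp (- A) t))"

lemma continuous_on_gramian_integrand:
  "continuous_on S (\<lambda>t. mexp (- A) t ** Q ** transpose (mexp (- A) t))"
  unfolding transpose_mexp by (intro continuous_intros)

lemma gramian_has_vector_derivative:
  assumes "t \<in> {0..T}"
  shows "(gramian A Q has_vector_derivative mexp (- A) t ** Q ** transpose (mexp (- A) t)) (at t within {0..T})"
  unfolding gramian_def
  by (rule integral_has_vector_derivative[OF continuous_on_gramian_integrand assms])

lemma transpose_minus: "transpose (- A) = - transpose A" for A :: "real^'n^'m"
  by (simp add: transpose_def vec_eq_iff)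

lemma gramian_quadratic_form:
  fixes A R :: "real^'n^'n"
  assumes "symmetric_matrix R"
  shows "v \<bullet> (gramian A (R ** R) T *v v) = output_energy R (- transpose A) T v"
proof -
  let ?X = "\<lambda>t. mexp (- A) t ** (R ** R) ** transpose (mexp (- A) t)"
  have "bounded_linear (\<lambda>X :: real^'n^'n. v \<bullet> (X *v v))"
    by (intro bounded_linear_inner_right_comp
        bounded_bilinear.bounded_linear_left[OF bounded_bilinear_matrix_vector_mult])
  then have "v \<bullet> (gramian A (R ** R) T *v v) = integral {0..T} (\<lambda>t. v \<bullet> (?X t *v v))"
    using integral_linear[of ?X "{0..T}" "\<lambda>X. v \<bullet> (X *v v)"]
    by (simp add: gramian_def o_def integrable_continuous_real continuous_on_gramian_integrand)
  moreover have "v \<bullet> (?X t *v v) = (norm (R *v (mexp (- transpose A) t *v v)))\<^sup>2" for t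
  proof -
    let ?E = "mexp (- transpose A) t"
    have "mexp (- A) t = transpose ?E" "transpose (mexp (- A) t) = ?E"
      by (simp_all add: transpose_mexp transpose_minus)
    then have "v \<bullet> (?X t *v v) = v \<bullet> (transpose ?E *v (R *v (R *v (?E *v v))))"
      by (simp add: matrix_vector_mul_assoc matrix_mul_assoc)
    also have "\<dots> = (?E *v v) \<bullet> (R *v (R *v (?E *v v)))"
      by (metis dot_lmul_matrix transpose_matrix_vector transpose_transpose)
    finally show ?thesis
      by (simp add: power2_norm_eq_inner symmetric_matrix_inner[OF assms])
  qed
  ultimately show ?thesis
    by (simp add: output_energy_def)
qed

text \<open>The lower bound is uniform over the unit sphere by compactness, since the quadratic forms
  increase with \<open>T\<close>.\<close>

lemma output_energy_coercive:
  fixes R A :: "real^'n^'n"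
  assumes R: "symmetric_matrix R"
    and unb: "\<And>v. v \<noteq> 0 \<Longrightarrow> \<exists>T\<ge>0. output_energy R (- transpose A) T v > K"
  obtains T where "T \<ge> 0" "\<And>v. K * (norm v)\<^sup>2 \<le> output_energy R (- transpose A) T v"
proof -
  let ?e = "output_energy R (- transpose A)"
  let ?U = "\<lambda>T. {v. K < ?e T v}"
  have "continuous_on UNIV (\<lambda>v. v \<bullet> (gramian A (R ** R) T *v v))" for T
    by (intro continuous_intros)
  then have "open (?U T)" for T
    unfolding gramian_quadratic_form[OF R] by (intro open_Collect_less) auto
  moreover have "sphere 0 1 \<subseteq> (\<Union>T\<in>{0..}. ?U T)"
  proof
    fix v :: "real^'n" assume "v \<in> sphere 0 1"
    then have "v \<noteq> 0" by auto
    with unb show "v \<in> (\<Union>T\<in>{0..}. ?U T)" by auto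
  qed
  ultimately obtain C where C: "C \<subseteq> {0..}" "finite C" "sphere 0 1 \<subseteq> (\<Union>T\<in>C. ?U T)"
    by (rule compactE_image[OF compact_sphere])
  define T where "T = Max (insert 0 C)"
  have "K * (norm v)\<^sup>2 \<le> ?e T v" for v
  proof (cases "v = 0")
    case False
    have "(1 / norm v) *\<^sub>R v \<in> sphere 0 1"
      using False by simp
    with C obtain S where "S \<in> C" "K < ?e S ((1 / norm v) *\<^sub>R v)"
      by blast
    moreover from this have "?e S ((1 / norm v) *\<^sub>R v) \<le> ?e T ((1 / norm v) *\<^sub>R v)"
      using C by (intro output_energy_mono) (simp add: T_def)
    ultimately have "K < (1 / norm v)\<^sup>2 * ?e T v"
      by (simp add: output_energy_scale)
    then show ?thesis
      using False by (simp add: power_divide less_divide_eq)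
  qed (simp add: output_energy_def)
  moreover have "T \<ge> 0"
    using C by (simp add: T_def)
  ultimately show thesis
    using that by blast
qed

text \<open>The transpose of the Kalman matrix has the blocks \<open>sqrt Q (A\<^sup>T)\<^sup>j\<close> and full column rank, so
  no non-zero vector is mapped to zero by all of them.\<close>

lemma kalman_condition_observable:
  fixes Q A :: "real^'n^'n"
  assumes "kalman_condition Q A" and R: "symmetric_matrix (matrix_sqrt Q)"
    and v: "\<And>k. matrix_sqrt Q *v (matrix_power (- transpose A) k *v v) = 0"
  shows "v = 0"
proof -
  let ?R = "matrix_sqrt Q"
  have "matrix_power (- M) k *v w = (- 1) ^ k *\<^sub>R (matrix_power M k *v w)" for M :: "real^'n^'n" and k w
    by (induction k arbitrary: w)
      (simp_all add: matrix_vector_mult_scaleR bounded_bilinear.minus_left[OF bounded_bilinear_matrix_vector_mult] flip: matrix_vector_mul_assoc)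
  with v have v': "?R *v (matrix_power (transpose A) k *v v) = 0" for k
    by (simp add: matrix_vector_mult_scaleR)
  have tR: "transpose ?R = ?R"
    using R by (simp add: symmetric_matrix_def)
  have "(transpose (kalman_matrix Q A) *v v) $ p = 0" for p
  proof -
    let ?X = "matrix_power A (to_nat_on UNIV (fst p)) ** ?R"
    have "(transpose (kalman_matrix Q A) *v v) $ p = (transpose ?X *v v) $ snd p"
      by (simp add: transpose_def kalman_matrix_def matrix_vector_mult_def)
    then show ?thesis
      by (simp add: matrix_transpose_mul tR transpose_matrix_power v' flip: matrix_vector_mul_assoc)
  qed
  then have "transpose (kalman_matrix Q A) *v v = transpose (kalman_matrix Q A) *v 0"
    by (simp add: vec_eq_iff)
  moreover have "inj ((*v) (transpose (kalman_matrix Q A)))"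
    using assms(1) by (simp add: kalman_condition_def rank_transpose flip: full_rank_injective)
  ultimately show ?thesis
    by (meson injD)
qed

section \<open>Steering to the origin with small energy\<close>

text \<open>With a Gramian \<open>S\<close> at the final time, the control \<open>g s = mexp (- A) s\<^sup>T p\<close>, \<open>S p = h\<close>, steers
  \<open>h\<close> to the origin and its energy is \<open>p \<bullet> S p\<close>. If \<open>S \<ge> K\<close> then this is at most \<open>\<bar>h\<bar>\<^sup>2 / K\<close>.\<close>

lemma steering_with_small_energy:
  fixes Q A :: "real^'n^'n"
  assumes Q: "symmetric_matrix Q" "nonneg_definite Q" and kal: "kalman_condition Q A"
    and spec: "spectral_bound A \<le> 0" and "0 < \<eta>"
  obtains T g \<xi> a where "0 \<le> T" "continuous_on {0..T} g" "\<xi> 0 = h" "\<xi> T = 0" "a 0 = (0::real)" "a T \<le> \<eta>"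
    "\<And>s. s \<in> {0..T} \<Longrightarrow> (\<xi> has_vector_derivative (A *v \<xi> s - Q *v g s)) (at s within {0..T})"
    "\<And>s. s \<in> {0..T} \<Longrightarrow> (a has_real_derivative (g s \<bullet> (Q *v g s)) / 2) (at s within {0..T})"
proof -
  define R where "R = matrix_sqrt Q"
  have R: "symmetric_matrix R" "R ** R = Q"
    using matrix_sqrt[OF Q] by (simp_all add: R_def)
  let ?B = "- transpose A"
  have specB: "0 \<le> Re l" if "l \<in> complex_spectrum ?B" for l
  proof -
    obtain v where v: "v \<noteq> 0" "complex_matrix ?B *v v = l *s v"
      using \<open>l \<in> complex_spectrum ?B\<close> by (auto simp: complex_spectrum_def complex_matrix_def)
    have "complex_matrix (transpose A) *v v = - (complex_matrix ?B *v v)"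
      by (simp add: complex_matrix_def vec_eq_iff matrix_vector_mult_def sum_negf)
    then have "complex_matrix (transpose A) *v v = (- l) *s v"
      using v(2) by (simp add: vec_eq_iff)
    then have "- l \<in> complex_spectrum (transpose A)"
      using v(1) by (auto simp: complex_spectrum_def complex_matrix_def)
    then have "Re (- l) \<le> spectral_bound A"
      using Re_le_spectral_bound complex_spectrum_transpose by blast
    with spec show ?thesis by simp
  qed
  \<comment> \<open>The summand \<open>1\<close> keeps \<open>K\<close> positive for \<open>h = 0\<close>.\<close>
  define K where "K = (h \<bullet> h + 1) / \<eta>"
  have K: "K > 0" "h \<bullet> h \<le> K * \<eta>"
    using \<open>0 < \<eta>\<close> by (auto simp: K_def add_nonneg_pos)
  have "\<exists>T\<ge>0. output_energy R ?B T v > K" if "v \<noteq> 0" for v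
    using output_energy_unbounded[of ?B R v K] specB that
      kalman_condition_observable[OF kal R(1)[unfolded R_def]] unfolding R_def by metis
  then obtain T where T: "T \<ge> 0" and coer: "\<And>v. K * (norm v)\<^sup>2 \<le> output_energy R ?B T v"
    using output_energy_coercive[OF R(1)] by blast
  define S where "S = gramian A Q"
  have coerS: "K * (v \<bullet> v) \<le> v \<bullet> (S T *v v)" for v
    using coer[of v] gramian_quadratic_form[OF R(1), of v A T]
    by (simp add: S_def R(2) power2_norm_eq_inner)
  have "inj ((*v) (S T))"
  proof (rule linear_injective_0[THEN iffD2, rule_format])
    fix v assume "S T *v v = 0"
    with coerS[of v] K have "v \<bullet> v \<le> 0"
      by (simp add: mult_le_0_iff)
    then show "v = 0"
      by (meson inner_ge_zero inner_eq_zero_iff order_antisym)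
  qed simp
  then have "surj ((*v) (S T))"
    by (intro linear_injective_imp_surjective) simp_all
  then obtain p where p: "S T *v p = h"
    by (metis surjD)
  have pe: "p \<bullet> h \<le> \<eta>"
  proof -
    have "K * (p \<bullet> p) \<le> p \<bullet> h"
      using coerS[of p] p by simp
    moreover have "(p \<bullet> h)\<^sup>2 \<le> (p \<bullet> p) * (h \<bullet> h)"
      by (rule Cauchy_Schwarz_ineq)
    ultimately have "K * (p \<bullet> h)\<^sup>2 \<le> (p \<bullet> h) * (K * \<eta>)"
      using K
      by (smt (verit) inner_ge_zero mult.assoc mult.commute mult_left_mono mult_mono mult_nonneg_nonneg)
    then have "(p \<bullet> h)\<^sup>2 \<le> (p \<bullet> h) * \<eta>"
      using K by simp
    then show ?thesis
      using \<open>0 < \<eta>\<close> by (smt (verit) mult_le_cancel_left power2_eq_square)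
  qed
  define g where "g s = transpose (mexp (- A) s) *v p" for s
  define \<xi> where "\<xi> s = mexp A s *v (h - S s *v p)" for s
  define a where "a s = (p \<bullet> (S s *v p)) / 2" for s
  have S0: "S 0 = 0"
    by (simp add: S_def gramian_def)
  have dS: "((\<lambda>s. S s *v p) has_vector_derivative mexp (- A) s *v (Q *v g s)) (at s within {0..T})"
    if "s \<in> {0..T}" for s
    using bounded_linear.has_vector_derivative[OF
        bounded_bilinear.bounded_linear_left[OF bounded_bilinear_matrix_vector_mult, of p]
        gramian_has_vector_derivative[OF that, of A Q]]
    by (simp add: S_def g_def matrix_vector_mul_assoc matrix_mul_assoc del: transpose_matrix_vector)
  show thesis
  proof (rule that[of T g \<xi> a])
    show "continuous_on {0..T} g"
      unfolding g_def transpose_mexp by (intro continuous_intros)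
    show "\<xi> 0 = h" "\<xi> T = 0" "a 0 = 0" "a T \<le> \<eta>"
      using pe \<open>0 < \<eta>\<close> by (auto simp: \<xi>_def a_def S0 p)
    fix s assume s: "s \<in> {0..T}"
    have "(\<xi> has_vector_derivative mexp A s *v (0 - mexp (- A) s *v (Q *v g s))
        + (A ** mexp A s) *v (h - S s *v p)) (at s within {0..T})"
      unfolding \<xi>_def
      by (intro bounded_bilinear.has_vector_derivative[OF bounded_bilinear_matrix_vector_mult]
          mexp_has_vector_derivative has_vector_derivative_diff has_vector_derivative_const dS[OF s])
    moreover have "mexp A s *v (0 - mexp (- A) s *v (Q *v g s)) = - (Q *v g s)"
      unfolding matrix_vector_mult_diff_distrib by (simp add: matrix_vector_mul_assoc matrix_mul_assoc)
    ultimately show "(\<xi> has_vector_derivative (A *v \<xi> s - Q *v g s)) (at s within {0..T})"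
      by (simp add: \<xi>_def matrix_vector_mul_assoc)
    have "((\<lambda>s. p \<bullet> (S s *v p)) has_vector_derivative p \<bullet> (mexp (- A) s *v (Q *v g s))) (at s within {0..T})"
      by (rule bounded_linear.has_vector_derivative[OF bounded_linear_inner_right dS[OF s]])
    moreover have "p \<bullet> (mexp (- A) s *v (Q *v g s)) = g s \<bullet> (Q *v g s)"
      unfolding g_def by (metis dot_lmul_matrix transpose_matrix_vector)
    ultimately show "(a has_real_derivative (g s \<bullet> (Q *v g s)) / 2) (at s within {0..T})"
      unfolding a_def by (intro DERIV_cdivide) (simp add: has_real_derivative_iff_has_vector_derivative)
  qed (rule T)
qed

section \<open>Derivatives of twice differentiable functions\<close>

lemma C2_has_derivative_gradient:
  fixes u :: "real^'n \<Rightarrow> real"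
  assumes "C2_function u"
  shows "(u has_derivative (\<lambda>h. h \<bullet> gradient u x)) (at x within S)"
proof -
  obtain f where f: "(u has_derivative f) (at x)"
    using assms by (auto simp: C2_function_def differentiable_def)
  have "f = (\<lambda>h. h \<bullet> adjoint f 1)"
    using adjoint_works[OF has_derivative_linear[OF f], of _ 1] by auto
  with f have D: "GDERIV u x :> adjoint f 1"
    by (simp add: gderiv_def)
  have "GDERIV u x :> gradient u x"
    unfolding gradient_def
  proof (rule theI[where P = "\<lambda>D. GDERIV u x :> D" and a = "adjoint f 1", OF D])
    fix E assume "GDERIV u x :> E"
    with D have "(\<lambda>h. h \<bullet> E) = (\<lambda>h. h \<bullet> adjoint f 1)"
      unfolding gderiv_def by (rule has_derivative_unique[rotated])
    then show "E = adjoint f 1"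
      by (metis vector_eq_ldot)
  qed
  then show ?thesis
    by (simp add: gderiv_def has_derivative_at_withinI)
qed

lemma C2_gradient_has_derivative:
  fixes u :: "real^'n \<Rightarrow> real"
  assumes "C2_function u"
  shows "(gradient u has_derivative (\<lambda>h. hessian u x *v h)) (at x within S)"
  using assms by (simp add: C2_function_def hessian_def has_derivative_at_withinI flip: jacobian_works)

lemma C2_chain_rule:
  fixes u :: "real^'n \<Rightarrow> real"
  assumes "C2_function u" and f: "(f has_vector_derivative f') (at s within S)"
  shows "((\<lambda>s. u (f s)) has_real_derivative f' \<bullet> gradient u (f s)) (at s within S)"
  using has_derivative_compose[OF f[unfolded has_vector_derivative_def]
      C2_has_derivative_gradient[OF assms(1)]]
  by (simp add: has_field_derivative_def mult_commute_abs)

lemma C2_gradient_chain_rule: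
  fixes u :: "real^'n \<Rightarrow> real"
  assumes "C2_function u" and f: "(f has_vector_derivative f') (at s within S)"
  shows "((\<lambda>s. d \<bullet> gradient u (f s)) has_real_derivative d \<bullet> (hessian u (f s) *v f')) (at s within S)"
  using has_derivative_inner_right[OF has_derivative_compose[OF f[unfolded has_vector_derivative_def]
      C2_gradient_has_derivative[OF assms(1)]], of d]
  by (simp add: has_field_derivative_def matrix_vector_mult_scaleR mult_commute_abs)

section \<open>Exponentially tilted translates\<close>

text \<open>Let \<open>\<xi>' = A \<xi> - Q g\<close> and \<open>a' = g \<bullet> Q g / 2\<close>. If \<open>L u = 0\<close> then, for every real \<open>c\<close>, the function
  \<open>exp (c z - c\<^sup>2 a(s)) u(y + c \<xi>(s))\<close> of \<open>(s, y, z)\<close> solves the backward equation of the diffusion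
  \<open>(Y, Z)\<close> in which \<open>Y\<close> is the Ornstein--Uhlenbeck process and \<open>Z\<close> the stochastic integral of \<open>g\<close>
  against its noise; this is the change of measure of Cameron, Martin and Girsanov in analytic
  form. Below, \<open>\<eta>\<close> and \<open>\<alpha>\<close> stand for \<open>\<xi>(s)\<close> and \<open>a(s)\<close>, and \<open>tilt_deriv\<close>, \<open>tilt_deriv2\<close> are the first
  two derivatives in the direction \<open>(d, e)\<close> of \<open>(y, z)\<close>.\<close>

definition tilt :: "(real^'n \<Rightarrow> real) \<Rightarrow> real \<Rightarrow> real^'n \<Rightarrow> real \<Rightarrow> real^'n \<Rightarrow> real \<Rightarrow> real" where
  "tilt u c \<eta> \<alpha> y z = exp (c * z - c\<^sup>2 * \<alpha>) * u (y + c *\<^sub>R \<eta>)"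

definition tilt_deriv ::
    "(real^'n \<Rightarrow> real) \<Rightarrow> real \<Rightarrow> real^'n \<Rightarrow> real \<Rightarrow> real^'n \<Rightarrow> real \<Rightarrow> real^'n \<Rightarrow> real \<Rightarrow> real" where
  "tilt_deriv u c \<eta> \<alpha> d e y z =
     exp (c * z - c\<^sup>2 * \<alpha>) * (c * e * u (y + c *\<^sub>R \<eta>) + d \<bullet> gradient u (y + c *\<^sub>R \<eta>))"

definition tilt_deriv2 ::
    "(real^'n \<Rightarrow> real) \<Rightarrow> real \<Rightarrow> real^'n \<Rightarrow> real \<Rightarrow> real^'n \<Rightarrow> real \<Rightarrow> real^'n \<Rightarrow> real \<Rightarrow> real" where
  "tilt_deriv2 u c \<eta> \<alpha> d e y z =
     exp (c * z - c\<^sup>2 * \<alpha>) * ((c * e)\<^sup>2 * u (y + c *\<^sub>R \<eta>) + 2 * (c * e) * (d \<bullet> gradient u (y + c *\<^sub>R \<eta>))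
       + d \<bullet> (hessian u (y + c *\<^sub>R \<eta>) *v d))"

lemma tilt_has_derivative_along_line:
  assumes "C2_function u"
  shows "((\<lambda>t. tilt u c \<eta> \<alpha> (y + t *\<^sub>R d) (z + t * e)) has_real_derivative
    tilt_deriv u c \<eta> \<alpha> d e (y + t *\<^sub>R d) (z + t * e)) (at t)"
proof -
  have "((\<lambda>t. y + t *\<^sub>R d + c *\<^sub>R \<eta>) has_vector_derivative d) (at t)"
    by (auto intro!: derivative_eq_intros)
  from C2_chain_rule[OF assms this] show ?thesis
    unfolding tilt_def tilt_deriv_def
    by (auto intro!: derivative_eq_intros simp: algebra_simps)
qed

lemma tilt_deriv_has_derivative_along_line:
  assumes "C2_function u"
  shows "((\<lambda>t. tilt_deriv u c \<eta> \<alpha> d e (y + t *\<^sub>R d) (z + t * e)) has_real_derivative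
    tilt_deriv2 u c \<eta> \<alpha> d e (y + t *\<^sub>R d) (z + t * e)) (at t)"
proof -
  have l: "((\<lambda>t. y + t *\<^sub>R d + c *\<^sub>R \<eta>) has_vector_derivative d) (at t)"
    by (auto intro!: derivative_eq_intros)
  show ?thesis
    using C2_chain_rule[OF assms l] C2_gradient_chain_rule[OF assms l, of d]
    unfolding tilt_deriv_def tilt_deriv2_def
    by (auto intro!: derivative_eq_intros simp: algebra_simps power2_eq_square)
qed

lemma tilt_has_derivative_in_time:
  assumes "C2_function u"
    and xi: "(\<xi> has_vector_derivative \<xi>') (at s within S)" and a: "(a has_real_derivative a') (at s within S)"
  shows "((\<lambda>s. tilt u c (\<xi> s) (a s) y z) has_real_derivative
    exp (c * z - c\<^sup>2 * a s) * (c * (\<xi>' \<bullet> gradient u (y + c *\<^sub>R \<xi> s)) - c\<^sup>2 * a' * u (y + c *\<^sub>R \<xi> s)))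
    (at s within S)"
proof -
  have "((\<lambda>s. y + c *\<^sub>R \<xi> s) has_vector_derivative c *\<^sub>R \<xi>') (at s within S)"
    using has_vector_derivative_add[OF has_vector_derivative_const
      bounded_linear.has_vector_derivative[OF bounded_linear_scaleR_right xi]] by simp
  from C2_chain_rule[OF assms(1) this] a show ?thesis
    unfolding tilt_def
    by (auto intro!: derivative_eq_intros simp: algebra_simps)
qed

text \<open>The columns of \<open>R\<close> are the directions of the noise: \<open>Q = R R\<^sup>T\<close> is the sum of their dyadic
  squares, which turns the second order part of the operator into a sum of second derivatives
  along lines.\<close>

lemma sum_inner_columns:
  fixes R :: "real^'n^'n"
  assumes "symmetric_matrix R"
  shows "(\<Sum>k\<in>UNIV. (v \<bullet> column k R) * (column k R \<bullet> w)) = v \<bullet> ((R ** R) *v w)"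
proof -
  have "column k R \<bullet> w = (R *v w) $ k" for k w
    using symmetric_matrix_inner[OF assms, of "axis k 1" w]
    by (simp add: matrix_vector_mult_basis inner_axis')
  moreover have "v \<bullet> ((R ** R) *v w) = (R *v v) \<bullet> (R *v w)"
    by (simp add: symmetric_matrix_inner[OF assms] flip: matrix_vector_mul_assoc)
  ultimately show ?thesis
    by (simp add: inner_commute[of v] inner_vec_def[of "R *v v"])
qed

lemma sum_quadratic_columns:
  fixes R H :: "real^'n^'n"
  assumes "symmetric_matrix R"
  shows "(\<Sum>k\<in>UNIV. column k R \<bullet> (H *v column k R)) = trace ((R ** R) ** H)"
proof -
  have "column k R \<bullet> (H *v column k R) = (R ** (H ** R)) $ k $ k" for k
  proof -
    have "column k R \<bullet> (H *v column k R) = axis k 1 \<bullet> ((R ** (H ** R)) *v axis k 1)"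
      by (simp add: symmetric_matrix_inner[OF assms] flip: matrix_vector_mult_basis matrix_vector_mul_assoc)
    then show ?thesis
      by (simp add: matrix_vector_mult_basis inner_axis' column_def)
  qed
  then have "(\<Sum>k\<in>UNIV. column k R \<bullet> (H *v column k R)) = trace (R ** (H ** R))"
    by (simp add: trace_def)
  then show ?thesis
    by (metis matrix_mul_assoc trace_mul_sym)
qed

lemma tilt_backward_equation:
  fixes Q A R :: "real^'n^'n"
  assumes R: "symmetric_matrix R" "R ** R = Q" and L: "\<And>x. ornstein_uhlenbeck Q A u x = 0"
    and xi': "\<xi>' = A *v \<eta> - Q *v g" and a': "a' = (g \<bullet> (Q *v g)) / 2"
  shows "exp (c * z - c\<^sup>2 * \<alpha>) * (c * (\<xi>' \<bullet> gradient u (y + c *\<^sub>R \<eta>)) - c\<^sup>2 * a' * u (y + c *\<^sub>R \<eta>))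
    + tilt_deriv u c \<eta> \<alpha> (A *v y) 0 y z
    + 1 / 2 * (\<Sum>k\<in>UNIV. tilt_deriv2 u c \<eta> \<alpha> (column k R) (g \<bullet> column k R) y z) = 0"
proof -
  let ?x = "y + c *\<^sub>R \<eta>"
  let ?D = "gradient u ?x"
  have "(\<Sum>k\<in>UNIV. (c * (g \<bullet> column k R))\<^sup>2 * u ?x) = c\<^sup>2 * (g \<bullet> (Q *v g)) * u ?x"
  proof -
    have "(\<Sum>k\<in>UNIV. (c * (g \<bullet> column k R))\<^sup>2 * u ?x)
        = (\<Sum>k\<in>UNIV. c\<^sup>2 * u ?x * ((g \<bullet> column k R) * (column k R \<bullet> g)))"
      by (simp add: power2_eq_square inner_commute mult_ac)
    then show ?thesis
      using sum_inner_columns[OF R(1), of g g] by (simp add: R(2) flip: sum_distrib_left)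
  qed
  moreover have "(\<Sum>k\<in>UNIV. 2 * (c * (g \<bullet> column k R)) * (column k R \<bullet> ?D)) = 2 * c * (g \<bullet> (Q *v ?D))"
    using sum_inner_columns[OF R(1), of g ?D] by (simp add: R(2) mult.assoc flip: sum_distrib_left)
  moreover have "g \<bullet> (Q *v ?D) = (Q *v g) \<bullet> ?D"
    by (simp add: symmetric_matrix_inner[OF R(1)] flip: R(2) matrix_vector_mul_assoc)
  moreover have "trace (Q ** hessian u ?x) = - 2 * ((A *v y) \<bullet> ?D + c * ((A *v \<eta>) \<bullet> ?D))"
    using L[of ?x]
    by (simp add: ornstein_uhlenbeck_def matrix_vector_right_distrib matrix_vector_mult_scaleR inner_add_left)
  ultimately have "(\<Sum>k\<in>UNIV. tilt_deriv2 u c \<eta> \<alpha> (column k R) (g \<bullet> column k R) y z)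
    = exp (c * z - c\<^sup>2 * \<alpha>) * (c\<^sup>2 * (g \<bullet> (Q *v g)) * u ?x + 2 * c * ((Q *v g) \<bullet> ?D)
        - 2 * ((A *v y) \<bullet> ?D + c * ((A *v \<eta>) \<bullet> ?D)))"
    using sum_quadratic_columns[OF R(1), of "hessian u ?x"]
    by (simp add: tilt_deriv2_def R(2) sum.distrib flip: sum_distrib_left)
  then show ?thesis
    by (simp add: tilt_deriv_def xi' a' inner_diff_left algebra_simps)
qed

section \<open>A comparison principle\<close>

lemma derivative_test_global_min:
  fixes f f1 :: "real \<Rightarrow> real"
  assumes f: "\<And>t. (f has_real_derivative f1 t) (at t)" and f1: "(f1 has_real_derivative f2) (at 0)"
    and min: "\<And>t. f 0 \<le> f t"
  shows "f1 0 = 0" "0 \<le> f2"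
proof -
  show z: "f1 0 = 0"
    using DERIV_local_min[OF f[of 0], of 1] min by auto
  show "0 \<le> f2"
  proof (rule ccontr)
    assume "\<not> 0 \<le> f2"
    then obtain d where d: "d > 0" "\<And>h. 0 < h \<Longrightarrow> h < d \<Longrightarrow> f1 h < 0"
      using DERIV_neg_dec_right[OF f1] z by auto
    obtain t where "0 < t" "t < d / 2" "f (d / 2) - f 0 = (d / 2 - 0) * f1 t"
      using MVT2[of 0 "d / 2" f f1] f d(1) by auto
    moreover from this have "(d / 2) * f1 t < 0"
      using d by (intro mult_pos_neg) auto
    ultimately show False
      using min[of "d / 2"] by simp
  qed
qed

lemma derivative_nonneg_at_left_min:
  fixes f :: "real \<Rightarrow> real"
  assumes "(f has_real_derivative l) (at s within {a..b})" "a \<le> s" "s < b"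
    and min: "\<And>t. t \<in> {a..b} \<Longrightarrow> f s \<le> f t"
  shows "0 \<le> l"
proof (rule ccontr)
  assume "\<not> 0 \<le> l"
  then obtain d where d: "d > 0" "\<And>h. 0 < h \<Longrightarrow> s + h \<in> {a..b} \<Longrightarrow> h < d \<Longrightarrow> f (s + h) < f s"
    using has_real_derivative_neg_dec_right[OF assms(1)] by (auto simp: not_le)
  define h where "h = min (d / 2) (b - s)"
  have "0 < h" "h < d" "s + h \<in> {a..b}"
    using d(1) assms(2,3) by (auto simp: h_def)
  with d(2)[of h] min[of "s + h"] show False by auto
qed

lemma coercive_attains_negative_min:
  fixes F :: "real \<Rightarrow> 'a::euclidean_space \<Rightarrow> real"
  assumes cont: "continuous_on ({0..T} \<times> UNIV) (\<lambda>(s, p). F s p)"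
    and coer: "\<And>s p. s \<in> {0..T} \<Longrightarrow> r \<le> norm p \<Longrightarrow> 0 \<le> F s p"
    and neg: "s1 \<in> {0..T}" "F s1 p1 < 0"
  shows "\<exists>s0\<in>{0..T}. \<exists>p0. F s0 p0 < 0 \<and> (\<forall>s\<in>{0..T}. \<forall>p. F s0 p0 \<le> F s p)"
proof -
  let ?K = "{0..T} \<times> cball (0 :: 'a) r"
  have inK: "(s, p) \<in> ?K" if "s \<in> {0..T}" "F s p < 0" for s p
    using coer[OF that(1), of p] that by (cases "r \<le> norm p") auto
  have K: "compact ?K" "?K \<noteq> {}"
    using inK[OF neg] by (blast intro: compact_Times compact_cball compact_Icc)+
  have "continuous_on ?K (\<lambda>(s, p). F s p)"
    by (rule continuous_on_subset[OF cont]) auto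
  from continuous_attains_inf[OF K this]
  obtain x where x: "x \<in> ?K" "\<And>y. y \<in> ?K \<Longrightarrow> (\<lambda>(s, p). F s p) x \<le> (\<lambda>(s, p). F s p) y"
    by blast
  obtain s0 p0 where "x = (s0, p0)" by fastforce
  with x have m: "s0 \<in> {0..T}" "\<And>s p. (s, p) \<in> ?K \<Longrightarrow> F s0 p0 \<le> F s p"
    by auto
  have n: "F s0 p0 < 0"
    using m(2)[OF inK[OF neg]] neg by simp
  have "F s0 p0 \<le> F s p" if "s \<in> {0..T}" for s p
    using m(2)[OF inK[OF that]] n by (meson linorder_not_le order.strict_implies_order order.trans)
  with m n show ?thesis by blast
qed

text \<open>With \<open>h = \<xi> 0\<close>, the tilted translates for \<open>c = 1\<close> and \<open>c = - 1\<close> have at time \<open>T\<close> the sum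
  \<open>2 exp (- a T) cosh z u(y) \<ge> 2 exp (- a T) u(y)\<close>, where the right-hand side is a multiple of the
  tilted translate for \<open>c = 0\<close>. All three solve the same backward equation, so the inequality
  persists down to time \<open>0\<close>, where at \<open>z = 0\<close> it is the claim. The sign of \<open>u\<close> and the linear bound
  keep the difference above a function of linear growth; hence a quadratic barrier
  \<open>\<epsilon> exp (\<kappa> (T - s)) (1 + \<bar>y\<bar>\<^sup>2 + z\<^sup>2)\<close> forces a negative minimum to be attained, and for large \<open>\<kappa>\<close>
  the barrier is a strict supersolution, which excludes such a minimum.\<close>

lemma translates_along_control:
  fixes Q A R :: "real^'n^'n" and u :: "real^'n \<Rightarrow> real"
  assumes R: "symmetric_matrix R" "R ** R = Q" and C2: "C2_function u"
    and L: "\<And>x. ornstein_uhlenbeck Q A u x = 0"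
    and pos: "\<And>x. 0 \<le> u x" and growth: "\<And>x. u x \<le> C * (1 + norm x)"
    and T: "0 \<le> T" and g: "continuous_on {0..T} g" and end_points: "\<xi> T = 0" "a 0 = 0"
    and xi: "\<And>s. s \<in> {0..T} \<Longrightarrow> (\<xi> has_vector_derivative (A *v \<xi> s - Q *v g s)) (at s within {0..T})"
    and a: "\<And>s. s \<in> {0..T} \<Longrightarrow> (a has_real_derivative (g s \<bullet> (Q *v g s)) / 2) (at s within {0..T})"
  shows "2 * exp (- a T) * u x \<le> u (x + \<xi> 0) + u (x - \<xi> 0)"
proof -
  define m where "m = exp (- a T)"
  have m: "m > 0" by (simp add: m_def)
  have C: "C \<ge> 0" using pos[of 0] growth[of 0] by simp
  define oA where "oA = onorm ((*v) A)"
  have "compact ((\<lambda>s. g s \<bullet> (Q *v g s)) ` {0..T})"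
    by (intro compact_continuous_image continuous_intros g) auto
  then have "bdd_above ((\<lambda>s. g s \<bullet> (Q *v g s)) ` {0..T})"
    by (intro bounded_imp_bdd_above compact_imp_bounded)
  then obtain M where M: "\<And>s. s \<in> {0..T} \<Longrightarrow> g s \<bullet> (Q *v g s) \<le> M"
    by (meson bdd_above.E imageI)
  \<comment> \<open>Large enough for the decay of the barrier in time to beat the drift and diffusion terms.\<close>
  define \<kappa> where "\<kappa> = 2 * oA + \<bar>trace Q\<bar> + \<bar>M\<bar> + 1"
  have oA0: "oA \<ge> 0"
    unfolding oA_def by (rule onorm_pos_le) simp
  have barrier: "- \<kappa> * (1 + y \<bullet> y + z\<^sup>2) + 2 * ((A *v y) \<bullet> y) + trace Q + g s \<bullet> (Q *v g s) < 0"
    if "s \<in> {0..T}" for s y z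
  proof -
    have "(A *v y) \<bullet> y \<le> norm (A *v y) * norm y"
      by (rule norm_cauchy_schwarz)
    also have "\<dots> \<le> (oA * norm y) * norm y"
      unfolding oA_def by (intro mult_right_mono onorm) auto
    finally have "(A *v y) \<bullet> y \<le> oA * (y \<bullet> y)"
      by (simp add: power2_norm_eq_inner[symmetric] power2_eq_square mult.assoc)
    moreover have "2 * oA * (y \<bullet> y) \<le> \<kappa> * (y \<bullet> y)" "0 \<le> \<kappa> * z\<^sup>2"
      using oA0 by (auto simp: \<kappa>_def intro!: mult_right_mono)
    moreover have "trace Q + g s \<bullet> (Q *v g s) < \<kappa>"
      using M[OF that] oA0 by (simp add: \<kappa>_def)
    ultimately show ?thesis
      by (simp add: algebra_simps)
  qed
  define w where "w s y z = tilt u 1 (\<xi> s) (a s) y z + tilt u (- 1) (\<xi> s) (a s) y z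
      - 2 * m * tilt u 0 (\<xi> s) (a s) y z" for s y z
  define G where "G \<epsilon> s y z = w s y z + \<epsilon> * exp (\<kappa> * (T - s)) * (1 + y \<bullet> y + z\<^sup>2)" for \<epsilon> s y z
  have nonneg: "0 \<le> G \<epsilon> 0 x 0" if "\<epsilon> > 0" for \<epsilon>
  proof (rule ccontr)
    assume "\<not> 0 \<le> G \<epsilon> 0 x 0"
    \<comment> \<open>Outside the ball of radius \<open>r\<close> the barrier dominates the linear bound on \<open>2 m u\<close>.\<close>
    define r where "r = max 1 (4 * m * C / \<epsilon>)"
    have u_cont: "continuous_on UNIV u"
      using C2 by (auto simp: C2_function_def intro!: continuous_at_imp_continuous_on
          differentiable_imp_continuous_within)
    have [continuous_intros]: "continuous_on S (\<lambda>q. u (f q))"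
      if "continuous_on S f" for S :: "(real \<times> (real^'n) \<times> real) set" and f
      by (rule continuous_on_compose2[OF u_cont that]) auto
    have xi_cont: "continuous_on {0..T} \<xi>"
      by (rule continuous_on_vector_derivative[OF xi])
    have [continuous_intros]: "continuous_on ({0..T} \<times> S) (\<lambda>q. \<xi> (fst q))" for S :: "((real^'n) \<times> real) set"
      by (rule continuous_on_compose2[OF xi_cont continuous_on_fst[OF continuous_on_id]]) auto
    have a_cont: "continuous_on {0..T} a"
      by (rule DERIV_continuous_on[OF a])
    have [continuous_intros]: "continuous_on ({0..T} \<times> S) (\<lambda>q. a (fst q))" for S :: "((real^'n) \<times> real) set"
      by (rule continuous_on_compose2[OF a_cont continuous_on_fst[OF continuous_on_id]]) auto
    have cont: "continuous_on ({0..T} \<times> UNIV) (\<lambda>(s, p). G \<epsilon> s (fst p) (snd p))"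
      unfolding G_def w_def tilt_def case_prod_beta by (intro continuous_intros)
    have coer: "0 \<le> G \<epsilon> s (fst p) (snd p)" if s: "s \<in> {0..T}" and p: "r \<le> norm p" for s p
    proof -
      have np: "norm p \<ge> 1" "4 * m * C \<le> \<epsilon> * norm p"
        using p \<open>\<epsilon> > 0\<close> by (simp_all add: r_def divide_le_eq mult.commute)
      have "2 * m * (C * (1 + norm p)) \<le> \<epsilon> * norm p * norm p"
      proof -
        have "2 * m * (C * (1 + norm p)) \<le> 2 * m * (C * (2 * norm p))"
          using np(1) m C by (intro mult_left_mono) simp_all
        also have "\<dots> = 4 * m * C * norm p"
          by simp
        also have "\<dots> \<le> \<epsilon> * norm p * norm p"
          using np(2) by (rule mult_right_mono) simp
        finally show ?thesis .
      qed
      moreover have "C * (1 + norm (fst p)) \<le> C * (1 + norm p)"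
        using C norm_fst_le[of "fst p" "snd p"] by (intro mult_left_mono) simp_all
      then have "2 * m * u (fst p) \<le> 2 * m * (C * (1 + norm p))"
        using m growth[of "fst p"] by (intro mult_left_mono) auto
      moreover have "norm p * norm p = fst p \<bullet> fst p + (snd p)\<^sup>2"
        by (simp add: norm_prod_def power2_norm_eq_inner flip: power2_eq_square)
      moreover have "\<kappa> \<ge> 0"
        using oA0 by (simp add: \<kappa>_def)
      then have "\<epsilon> * 1 * (1 + fst p \<bullet> fst p + (snd p)\<^sup>2)
          \<le> \<epsilon> * exp (\<kappa> * (T - s)) * (1 + fst p \<bullet> fst p + (snd p)\<^sup>2)"
        using s \<open>\<epsilon> > 0\<close> by (intro mult_right_mono mult_left_mono) auto
      moreover have "0 \<le> tilt u c \<eta> \<alpha> y z" for c \<eta> \<alpha> y z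
        by (simp add: tilt_def pos)
      then have "- 2 * m * u (fst p) \<le> w s (fst p) (snd p)"
        unfolding w_def by (simp add: tilt_def[of u 0] add_nonneg_nonneg)
      ultimately show ?thesis
        using \<open>\<epsilon> > 0\<close> by (simp add: G_def algebra_simps)
    qed
    have neg: "0 \<in> {0..T}" "G \<epsilon> 0 (fst (x, 0)) (snd (x, 0)) < 0"
      using T \<open>\<not> 0 \<le> G \<epsilon> 0 x 0\<close> by auto
    from coercive_attains_negative_min[where F = "\<lambda>s p. G \<epsilon> s (fst p) (snd p)", OF cont coer neg]
    obtain s p where s: "s \<in> {0..T}" and Gneg: "G \<epsilon> s (fst p) (snd p) < 0"
      and min: "\<And>s' p'. s' \<in> {0..T} \<Longrightarrow> G \<epsilon> s (fst p) (snd p) \<le> G \<epsilon> s' (fst p') (snd p')"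
      by blast
    obtain y z where p: "p = (y, z)" by fastforce
    have min': "G \<epsilon> s y z \<le> G \<epsilon> s' y' z'" if "s' \<in> {0..T}" for s' y' z'
      using min[OF that, of "(y', z')"] p by simp
    have "s \<noteq> T"
    proof
      assume "s = T"
      have "2 \<le> exp z + exp (- z)"
        using cosh_real_ge_1[of z] by (simp add: cosh_def)
      then have "2 * (m * u y) \<le> (exp z + exp (- z)) * (m * u y)"
        using m pos by (intro mult_right_mono) auto
      then have "0 \<le> w T y z"
        by (simp add: w_def tilt_def end_points m_def exp_diff exp_minus algebra_simps divide_inverse)
      moreover have "0 \<le> \<epsilon> * (1 + y \<bullet> y + z\<^sup>2)"
        using \<open>\<epsilon> > 0\<close> by simp
      ultimately show False
        using Gneg by (simp add: G_def p \<open>s = T\<close>)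
    qed
    with s have sT: "0 \<le> s" "s < T" by auto
    define E where "E = \<epsilon> * exp (\<kappa> * (T - s))"
    have E: "E > 0" using \<open>\<epsilon> > 0\<close> by (simp add: E_def)
    let ?\<xi>' = "A *v \<xi> s - Q *v g s" and ?a' = "(g s \<bullet> (Q *v g s)) / 2"
    define time where "time c = exp (c * z - c\<^sup>2 * a s) *
        (c * (?\<xi>' \<bullet> gradient u (y + c *\<^sub>R \<xi> s)) - c\<^sup>2 * ?a' * u (y + c *\<^sub>R \<xi> s))" for c
    define line1 where "line1 d e t = tilt_deriv u 1 (\<xi> s) (a s) d e (y + t *\<^sub>R d) (z + t * e)
        + tilt_deriv u (- 1) (\<xi> s) (a s) d e (y + t *\<^sub>R d) (z + t * e)
        - 2 * m * tilt_deriv u 0 (\<xi> s) (a s) d e (y + t *\<^sub>R d) (z + t * e)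
        + E * (2 * (d \<bullet> (y + t *\<^sub>R d)) + 2 * e * (z + t * e))" for d e t
    define line2 where "line2 d e = tilt_deriv2 u 1 (\<xi> s) (a s) d e y z
        + tilt_deriv2 u (- 1) (\<xi> s) (a s) d e y z - 2 * m * tilt_deriv2 u 0 (\<xi> s) (a s) d e y z
        + E * (2 * (d \<bullet> d) + 2 * e\<^sup>2)" for d e
    have d1: "((\<lambda>t. G \<epsilon> s (y + t *\<^sub>R d) (z + t * e)) has_real_derivative line1 d e t) (at t)" for d e t
    proof -
      have "((\<lambda>t. 1 + (y + t *\<^sub>R d) \<bullet> (y + t *\<^sub>R d) + (z + t * e)\<^sup>2) has_real_derivative
          2 * (d \<bullet> (y + t *\<^sub>R d)) + 2 * e * (z + t * e)) (at t)"
        by (simp add: inner_add_left inner_add_right inner_commute[of d y])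
          (auto intro!: derivative_eq_intros simp: algebra_simps)
      note barrier_deriv = DERIV_cmult[OF this]
      note tilt_deriv = tilt_has_derivative_along_line[OF C2]
      show ?thesis
        unfolding G_def w_def line1_def E_def
        by (rule DERIV_add[OF DERIV_diff[OF DERIV_add DERIV_cmult] barrier_deriv])
          (rule tilt_deriv)+
    qed
    have d2: "(line1 d e has_real_derivative line2 d e) (at 0)" for d e
    proof -
      have "((\<lambda>t. 2 * (d \<bullet> (y + t *\<^sub>R d)) + 2 * e * (z + t * e)) has_real_derivative
          2 * (d \<bullet> d) + 2 * e\<^sup>2) (at 0)"
        by (simp add: inner_add_right)
          (auto intro!: derivative_eq_intros simp: algebra_simps power2_eq_square)
      note barrier_deriv = DERIV_cmult[OF this]
      have tilt_deriv: "((\<lambda>t. tilt_deriv u c (\<xi> s) (a s) d e (y + t *\<^sub>R d) (z + t * e)) has_real_derivative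
          tilt_deriv2 u c (\<xi> s) (a s) d e y z) (at 0)" for c
        using tilt_deriv_has_derivative_along_line[OF C2, of c "\<xi> s" "a s" d e y z 0] by simp
      show ?thesis
        unfolding line1_def line2_def
        by (rule DERIV_add[OF DERIV_diff[OF DERIV_add DERIV_cmult] barrier_deriv])
          (rule tilt_deriv)+
    qed
    have "G \<epsilon> s (y + 0 *\<^sub>R d) (z + 0 * e) \<le> G \<epsilon> s (y + t *\<^sub>R d) (z + t * e)" for d e t
      using min'[OF s] by simp
    \<comment> \<open>Every line through the minimum gives a first and a second order condition.\<close>
    note test = derivative_test_global_min[OF d1 d2 this]
    have drift: "line1 (A *v y) 0 0 = 0"
      by (rule test)
    have diffusion: "0 \<le> (\<Sum>k\<in>UNIV. line2 (column k R) (g s \<bullet> column k R))"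
      by (intro sum_nonneg test)
    have "((\<lambda>s. G \<epsilon> s y z) has_real_derivative
        time 1 + time (- 1) - 2 * m * time 0 + - \<kappa> * E * (1 + y \<bullet> y + z\<^sup>2)) (at s within {0..T})"
      unfolding G_def w_def
    proof (rule DERIV_add[OF DERIV_diff[OF DERIV_add DERIV_cmult]])
      show "((\<lambda>s. \<epsilon> * exp (\<kappa> * (T - s)) * (1 + y \<bullet> y + z\<^sup>2)) has_real_derivative
          - \<kappa> * E * (1 + y \<bullet> y + z\<^sup>2)) (at s within {0..T})"
        unfolding E_def by (auto intro!: derivative_eq_intros)
    qed (unfold time_def, (rule tilt_has_derivative_in_time[OF C2 xi[OF s] a[OF s]])+)
    then have time: "0 \<le> time 1 + time (- 1) - 2 * m * time 0 + - \<kappa> * E * (1 + y \<bullet> y + z\<^sup>2)"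
      by (rule derivative_nonneg_at_left_min[OF _ sT]) (rule min')
    define S where "S c = (\<Sum>k\<in>UNIV. tilt_deriv2 u c (\<xi> s) (a s) (column k R) (g s \<bullet> column k R) y z)" for c
    have eq: "time c + tilt_deriv u c (\<xi> s) (a s) (A *v y) 0 y z + 1 / 2 * S c = 0" for c
      unfolding time_def S_def by (rule tilt_backward_equation[OF R L refl refl])
    have "(\<Sum>k\<in>UNIV. column k R \<bullet> column k R) = trace Q"
      using sum_quadratic_columns[OF R(1), of "mat 1"] by (simp add: R(2))
    moreover have "(\<Sum>k\<in>UNIV. (g s \<bullet> column k R)\<^sup>2) = g s \<bullet> (Q *v g s)"
      using sum_inner_columns[OF R(1), of "g s" "g s"]
      by (simp add: R(2) power2_eq_square inner_commute)
    ultimately have sum2: "(\<Sum>k\<in>UNIV. line2 (column k R) (g s \<bullet> column k R))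
        = S 1 + S (- 1) - 2 * m * S 0 + E * (2 * trace Q + 2 * (g s \<bullet> (Q *v g s)))"
      by (simp add: line2_def S_def sum.distrib sum_subtractf flip: sum_distrib_left)
    \<comment> \<open>Time, drift and half the diffusion terms of the three solutions cancel.\<close>
    have "0 \<le> E * (- \<kappa> * (1 + y \<bullet> y + z\<^sup>2) + 2 * ((A *v y) \<bullet> y) + trace Q + g s \<bullet> (Q *v g s))"
      using time drift diffusion[unfolded sum2] eq[of 1] eq[of "- 1"] arg_cong[OF eq[of 0], of "\<lambda>t. m * t"]
      by (simp add: line1_def algebra_simps)
    with barrier[OF s, of y z] E show False
      by (metis linorder_not_le mult_pos_neg)
  qed
  have "0 \<le> w 0 x 0"
  proof (rule field_le_epsilon)
    fix e :: real assume "e > 0"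
    define b where "b = exp (\<kappa> * T) * (1 + x \<bullet> x)"
    have b: "b > 0" by (simp add: b_def add_pos_nonneg)
    have "G (e / b) 0 x 0 = w 0 x 0 + e / b * b"
      unfolding G_def b_def by simp
    then show "0 \<le> w 0 x 0 + e"
      using nonneg[of "e / b"] \<open>e > 0\<close> b by simp
  qed
  then show ?thesis
    by (simp add: w_def tilt_def end_points m_def)
qed

section \<open>Liouville theorem\<close>

text \<open>Midpoint convexity along the arithmetic progression \<open>x, x + h, x + 2 h, \<dots>\<close> makes the values
  of \<open>u\<close> grow at least linearly with slope \<open>u (x + h) - u x\<close>, so sublinear growth leaves no
  direction in which \<open>u\<close> increases.\<close>

lemma midpoint_convex_sublinear_constant:
  fixes u :: "'a::real_normed_vector \<Rightarrow> real"
  assumes conv: "\<And>x h. 2 * u x \<le> u (x + h) + u (x - h)"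
    and growth: "\<And>x. u x \<le> C * (1 + norm x powr \<delta>)" and "0 < \<delta>" "\<delta> < 1" "0 < C"
  shows "u constant_on UNIV"
proof -
  have le: "u (x + h) \<le> u x" for x h
  proof (rule ccontr)
    assume "\<not> u (x + h) \<le> u x"
    define d where "d = u (x + h) - u x"
    have d: "d > 0" using \<open>\<not> u (x + h) \<le> u x\<close> by (simp add: d_def)
    have slope: "d \<le> u (x + real (Suc n) *\<^sub>R h) - u (x + real n *\<^sub>R h)" for n
    proof (induction n)
      case (Suc n)
      have eqs: "x + real (Suc n) *\<^sub>R h + h = x + real (Suc (Suc n)) *\<^sub>R h"
        "x + real (Suc n) *\<^sub>R h - h = x + real n *\<^sub>R h"
        by (simp_all add: algebra_simps scaleR_2)
      show ?case
        using conv[of "x + real (Suc n) *\<^sub>R h" h] Suc unfolding eqs by linarith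
    qed (simp add: d_def)
    have lower: "u x + real n * d \<le> u (x + real n *\<^sub>R h)" for n
    proof (induction n)
      case (Suc n)
      with slope[of n] show ?case by (simp add: algebra_simps)
    qed simp
    have upper: "real n * d \<le> C * (1 + (norm x + real n * norm h) powr \<delta>) - u x" for n
    proof -
      have "norm (x + real n *\<^sub>R h) powr \<delta> \<le> (norm x + real n * norm h) powr \<delta>"
        using \<open>0 < \<delta>\<close> norm_triangle_ineq[of x "real n *\<^sub>R h"] by (intro powr_mono2) auto
      then have "C * (1 + norm (x + real n *\<^sub>R h) powr \<delta>) \<le> C * (1 + (norm x + real n * norm h) powr \<delta>)"
        using \<open>0 < C\<close> by simp
      with lower[of n] growth[of "x + real n *\<^sub>R h"] show ?thesis
        by linarith
    qed
    have "h \<noteq> 0" using \<open>\<not> u (x + h) \<le> u x\<close> by auto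
    then have "norm x \<ge> 0" "norm h > 0" by auto
    then have "((\<lambda>n. (C * (1 + (norm x + real n * norm h) powr \<delta>) - u x) / real n) \<longlongrightarrow> 0) sequentially"
      using \<open>0 < \<delta>\<close> \<open>\<delta> < 1\<close> \<open>0 < C\<close> by real_asymp
    moreover have "eventually (\<lambda>n. d \<le> (C * (1 + (norm x + real n * norm h) powr \<delta>) - u x) / real n) sequentially"
      using eventually_gt_at_top[of 0]
      by eventually_elim (use upper in \<open>simp add: le_divide_eq mult.commute\<close>)
    ultimately have "d \<le> 0"
      by (intro tendsto_lowerbound[of _ 0 sequentially]) auto
    with d show False by simp
  qed
  have "u x = u 0" for x
    using le[of 0 x] le[of x "- x"] by simp
  then show ?thesis
    by (auto simp: constant_on_def)
qed

theorem theorem3p4: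
  fixes Q A :: "real^'n^'n" and u :: "real^'n \<Rightarrow> real"
  assumes "symmetric_matrix Q" and "nonneg_definite Q"
    and "kalman_condition Q A"
    and "C2_function u"
    and "\<forall>x. 0 \<le> u x"
    and "\<forall>x. ornstein_uhlenbeck Q A u x = 0"
    and "\<exists>\<delta> C. 0 \<le> \<delta> \<and> \<delta> < 1 \<and> 0 < C \<and> (\<forall>x. \<bar>u x\<bar> \<le> C * (1 + rpow (norm x) \<delta>))"
    and "spectral_bound A \<le> 0"
  shows "u constant_on UNIV"
proof -
  obtain \<delta> C where dC: "0 \<le> \<delta>" "\<delta> < 1" "0 < C" and bd: "\<And>x. \<bar>u x\<bar> \<le> C * (1 + rpow (norm x) \<delta>)"
    using assms(7) by blast
  \<comment> \<open>This exponent is positive also for \<open>\<delta> = 0\<close>, which dispenses with the convention for \<open>0\<^sup>0\<close>.\<close>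
  define \<gamma> where "\<gamma> = (1 + \<delta>) / 2"
  have \<gamma>: "0 < \<gamma>" "\<gamma> < 1" "\<delta> \<le> \<gamma>"
    using dC by (auto simp: \<gamma>_def)
  have "rpow r \<delta> \<le> 1 + r powr \<gamma>" if "r \<ge> 0" for r
  proof (cases "r \<le> 1")
    case True
    then have "r powr \<delta> \<le> 1"
      using that dC by (simp add: powr_le1)
    then show ?thesis
      by (simp add: rpow_def add_increasing2)
  next
    case False
    then have "r powr \<delta> \<le> r powr \<gamma>"
      using \<gamma> by (intro powr_mono) auto
    then show ?thesis
      by (simp add: rpow_def add_increasing)
  qed
  then have "C * (1 + rpow (norm x) \<delta>) \<le> C * (2 + norm x powr \<gamma>)" for x
    using dC by (intro mult_left_mono) (auto simp: add.commute)
  moreover have "C * (2 + norm x powr \<gamma>) \<le> (2 * C) * (1 + norm x powr \<gamma>)" for x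
    using dC by (simp add: algebra_simps)
  ultimately have sublinear: "u x \<le> (2 * C) * (1 + norm x powr \<gamma>)" for x
    using bd[of x] by (smt (verit))
  have "r powr \<gamma> \<le> 1 + r" if "r \<ge> 0" for r
    using that \<gamma> powr_le1[of \<gamma> r] powr_mono[of \<gamma> 1 r] by (cases "r \<le> 1") auto
  then have "(2 * C) * (1 + norm x powr \<gamma>) \<le> (2 * C) * (1 + (1 + norm x))" for x
    using dC by (intro mult_left_mono) auto
  moreover have "(2 * C) * (1 + (1 + norm x)) \<le> (4 * C) * (1 + norm x)" for x
    using dC by (simp add: algebra_simps)
  ultimately have linear: "u x \<le> (4 * C) * (1 + norm x)" for x
    using sublinear[of x] by (smt (verit))
  have conv: "2 * u x \<le> u (x + h) + u (x - h)" for x h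
  proof -
    have "2 * exp (- \<eta>) * u x \<le> u (x + h) + u (x - h)" if \<eta>: "\<eta> > 0" for \<eta>
    proof -
      obtain T g \<xi> a where c: "0 \<le> T" "continuous_on {0..T} g" "\<xi> 0 = h" "\<xi> T = 0" "a 0 = (0::real)" "a T \<le> \<eta>"
        "\<And>s. s \<in> {0..T} \<Longrightarrow> (\<xi> has_vector_derivative (A *v \<xi> s - Q *v g s)) (at s within {0..T})"
        "\<And>s. s \<in> {0..T} \<Longrightarrow> (a has_real_derivative (g s \<bullet> (Q *v g s)) / 2) (at s within {0..T})"
        using steering_with_small_energy[OF assms(1-3,8) \<eta>, of h] by blast
      have "2 * exp (- \<eta>) * u x \<le> 2 * exp (- a T) * u x"
        using c(6) assms(5) by (intro mult_right_mono) auto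
      also have "\<dots> \<le> u (x + h) + u (x - h)"
        using translates_along_control[OF matrix_sqrt[OF assms(1,2)] assms(4) _ _ linear c(1,2,4,5,7,8)]
          assms(5,6) c(3) by simp
      finally show ?thesis .
    qed
    then have "eventually (\<lambda>\<eta>. 2 * exp (- \<eta>) * u x \<le> u (x + h) + u (x - h)) (at_right 0)"
      by (auto simp: eventually_at_filter)
    moreover have "((\<lambda>\<eta>. 2 * exp (- \<eta>) * u x) \<longlongrightarrow> 2 * exp (- 0) * u x) (at_right 0)"
      by (intro tendsto_intros)
    ultimately show ?thesis
      using tendsto_upperbound[of "\<lambda>\<eta>. 2 * exp (- \<eta>) * u x" _ "at_right 0"] by simp
  qed
  show ?thesis
    by (rule midpoint_convex_sublinear_constant[OF conv sublinear]) (use \<gamma> dC in auto)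
qed

end
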